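(* Fix $\beta>0$ and $h\in\mathbb{R}$. For each $N$, let $\mathcal{G}=\mathcal{G}_N=([N],E)$ be a graph with average degree $d=d_N$ and maximum degree $d_{\max}$, and let $G=G_N=(g_{ij})$ be a symmetric $N\times N$ random matrix with vanishing diagonal such that $(g_{ij})_{i>j}$ are independent with $\mathbb{E}g_{ij}=0$, $\mathbb{E}g_{ij}^2=1$ and $\mathbb{E}|g_{ij}|^3\le B$, where $B>0$ is a finite constant independent of $N$. Suppose that $d_{\max}\le Cd$ for all $N$, where $C>0$ is a constant independent of $N$, and that $d\to\infty$ as $N\to\infty$. Let $J=\frac1{\sqrt d}A\circ G$, where $A$ is the adjacency matrix of $\mathcal{G}$. Then there exist positive constants $c_0,c,K$, independent of $N$, such that for all $N$ $$\mathbb{P}\Bigl(\min_{\sigma\in\{-1,+1\}^N}\widetilde T_N(\sigma)\le c_0\Bigr)\le K\exp(-cN).$$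
   Context: $[N]=\{1,\dots,N\}$, $N\ge2$; the graphs are deterministic, simple and undirected with at least one edge (so that $d>0$); $d=2|E|/N$; $A\circ G$ is the entrywise product. For $\sigma\in\{-1,+1\}^N$, $m_i(\sigma)=\sum_{j=1}^NJ_{ij}\sigma_j$, $\theta_i(\sigma)=\operatorname{sech}^2(\beta m_i(\sigma)+h)$, and $$\widetilde T_N(\sigma)=\frac1{N^2}\sum_{i,j\in[N]}\theta_i(\sigma)\theta_j(\sigma)(m_i(\sigma)-m_j(\sigma))^2.$$ *)

theory Defs
  imports "HOL-Probability.Probability"
begin

text \<open>A simple undirected graph on the vertex set \<open>{1..N}\<close> is given by its set of edges, each edge
  being a two-element set of vertices. Matrices are functions \<open>nat \<Rightarrow> nat \<Rightarrow> real\<close> of which only the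
  entries with both indices in \<open>{1..N}\<close> matter.\<close>

definition simple_graph :: "nat \<Rightarrow> nat set set \<Rightarrow> bool" where
  "simple_graph N E \<longleftrightarrow> (\<forall>e\<in>E. e \<subseteq> {1..N} \<and> card e = 2)"

definition degree :: "nat set set \<Rightarrow> nat \<Rightarrow> nat" where
  "degree E v = card {e \<in> E. v \<in> e}"

definition max_degree :: "nat \<Rightarrow> nat set set \<Rightarrow> nat" where
  "max_degree N E = Max (degree E ` {1..N})"

definition avg_degree :: "nat \<Rightarrow> nat set set \<Rightarrow> real" where
  "avg_degree N E = 2 * real (card E) / real N"

definition adj_mat :: "nat set set \<Rightarrow> nat \<Rightarrow> nat \<Rightarrow> real" where
  "adj_mat E i j = (if {i, j} \<in> E then 1 else 0)"

definition coupling :: "nat \<Rightarrow> nat set set \<Rightarrow> (nat \<Rightarrow> nat \<Rightarrow> real) \<Rightarrow> nat \<Rightarrow> nat \<Rightarrow> real" where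
  "coupling N E G i j = 1 / sqrt (avg_degree N E) * (adj_mat E i j * G i j)"

definition sech :: "real \<Rightarrow> real" where
  "sech x = 1 / cosh x"

text \<open>Spin configurations are extensional functions on \<open>{1..N}\<close>, so that there are exactly
  \<open>2 ^ N\<close> of them.\<close>

definition spins :: "nat \<Rightarrow> (nat \<Rightarrow> real) set" where
  "spins N = {1..N} \<rightarrow>\<^sub>E {-1, 1}"

definition local_field :: "nat \<Rightarrow> (nat \<Rightarrow> nat \<Rightarrow> real) \<Rightarrow> (nat \<Rightarrow> real) \<Rightarrow> nat \<Rightarrow> real" where
  "local_field N J \<sigma> i = (\<Sum>j=1..N. J i j * \<sigma> j)"

definition theta ::
  "real \<Rightarrow> real \<Rightarrow> nat \<Rightarrow> (nat \<Rightarrow> nat \<Rightarrow> real) \<Rightarrow> (nat \<Rightarrow> real) \<Rightarrow> nat \<Rightarrow> real" where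
  "theta \<beta> h N J \<sigma> i = (sech (\<beta> * local_field N J \<sigma> i + h))\<^sup>2"

definition T_tilde ::
  "real \<Rightarrow> real \<Rightarrow> nat \<Rightarrow> (nat \<Rightarrow> nat \<Rightarrow> real) \<Rightarrow> (nat \<Rightarrow> real) \<Rightarrow> real" where
  "T_tilde \<beta> h N J \<sigma> = 1 / (real N)\<^sup>2 *
    (\<Sum>i=1..N. \<Sum>j=1..N. theta \<beta> h N J \<sigma> i * theta \<beta> h N J \<sigma> j *
      (local_field N J \<sigma> i - local_field N J \<sigma> j)\<^sup>2)"

end

theory Submission
  imports Defs
begin

text \<open>
  Write \<open>d\<close> for the average degree. For a fixed \<open>\<sigma>\<close> every local field splits as \<open>m\<^sub>i = X\<^sub>i + Y\<^sub>i\<close>, where \<open>X\<^sub>i\<close>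
  collects the edges from \<open>i\<close> to smaller vertices and \<open>Y\<^sub>i\<close> those to larger vertices. If \<open>T_tilde\<close> is small
  at \<open>\<sigma>\<close>, then on every set \<open>S\<close> of at least \<open>N / (4 C)\<close> vertices one of two things happens
  (\<open>concentrated_or_large\<close>): half of the \<open>m\<^sub>i\<close> exceed a large constant \<open>R\<close> in absolute value, or a
  quarter of them lie within \<open>\<delta>\<close> of a common value in \<open>[-R, R]\<close>, hence within \<open>2 \<delta>\<close> of a
  point of a finite grid that does not depend on \<open>N\<close>. In the first case a quarter of the \<open>X\<^sub>i\<close>, or a
  quarter of the \<open>Y\<^sub>i\<close>, exceed \<open>R / 2\<close> in absolute value.

  So it is enough to bound the probability that all \<open>i\<close> in a given set \<open>I\<close> show one of these
  behaviours, and to sum over \<open>\<sigma>\<close>, over \<open>I \<subseteq> S\<close> with \<open>card I \<ge> N / (16 C)\<close> and over the grid, which costs a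
  factor of order \<open>4\<^sup>N\<close>. A bound \<open>p ^ card I\<close> with \<open>p = 8 powr (- 16 C)\<close> leaves \<open>2\<^sup>-\<^sup>N\<close>.

  The bound \<open>p ^ card I\<close> comes from treating the vertices one after the other in increasing order
  (\<open>prob_all_pairs_le_power\<close>): the entries that make up \<open>X\<^sub>i\<close> enter neither \<open>Y\<^sub>i\<close> nor any \<open>X\<^sub>k\<close> or \<open>Y\<^sub>k\<close>
  with \<open>k > i\<close>. Conditionally on all other entries, the event at \<open>i\<close> therefore has probability
  at most the supremum over \<open>y\<close> of the probability of the event with \<open>Y\<^sub>i\<close> replaced by \<open>y\<close>. In decreasing
  order the roles of \<open>X\<close> and \<open>Y\<close> are exchanged. For the large values, this supremum is at most
  \<open>4 C / R\<^sup>2\<close> by Chebyshev's inequality, so that no moment beyond the second is needed there. For the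
  concentration near a grid point it is a small ball probability
  (\<open>small_ball_weighted_sum\<close>), which is small once \<open>\<delta>\<close> is small and \<open>d\<close> is large, provided that \<open>i\<close> has
  at least \<open>d / 4\<close> smaller neighbours; the third moments control the characteristic functions.
  Since the degrees average to \<open>d\<close> and are at most \<open>C d\<close>, there are at least \<open>N / (4 C)\<close>
  vertices with \<open>d / 4\<close> smaller neighbours, or as many with \<open>d / 4\<close> larger ones
  (\<open>many_large_blocks\<close>); these form \<open>S\<close> and decide which of the two orders is used.
  The finitely many \<open>N\<close> for which \<open>d\<close> is not yet large are absorbed in \<open>K\<close>.
\<close>

section \<open>Characteristic functions and Gaussian smoothing\<close>

lemma (in prob_space) norm_char_le_exp:
  fixes X :: "'a \<Rightarrow> real"
  assumes X [measurable]: "random_variable borel X"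
    and int: "integrable M (\<lambda>\<omega>. \<bar>X \<omega>\<bar> ^ 3)" "integrable M X" "integrable M (\<lambda>\<omega>. (X \<omega>)\<^sup>2)"
    and mean: "expectation X = 0" and var: "expectation (\<lambda>\<omega>. (X \<omega>)\<^sup>2) = 1"
    and third: "expectation (\<lambda>\<omega>. \<bar>X \<omega>\<bar> ^ 3) \<le> B"
    and B: "1 \<le> B" and t: "\<bar>t\<bar> * B \<le> 1"
  shows "norm (char (distr M borel X) t) \<le> exp (- t\<^sup>2 / 3)"
proof -
  have "\<bar>t\<bar> \<le> \<bar>t\<bar> * B" using B by (simp add: mult_le_cancel_left1)
  then have t1: "\<bar>t\<bar> \<le> 1" using t by linarith
  then have t2: "t\<^sup>2 \<le> 1" by (simp add: abs_le_square_iff[of t 1, simplified])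
  \<comment> \<open>The remainder is at most a third of the quadratic term, because \<open>\<bar>t\<bar> * B \<le> 1\<close>.\<close>
  have "cmod (char (distr M borel X) t - (1 - t\<^sup>2 * 1 / 2)) \<le>
      (t\<^sup>2 / 6) * expectation (\<lambda>x. min (6 * (X x)\<^sup>2) (\<bar>t\<bar> * \<bar>X x\<bar>^3))"
    using int mean var by (intro char_approx3') (auto simp: mean)
  also have "expectation (\<lambda>x. min (6 * (X x)\<^sup>2) (\<bar>t\<bar> * \<bar>X x\<bar>^3)) \<le>
      expectation (\<lambda>x. \<bar>t\<bar> * \<bar>X x\<bar>^3)"
    using int by (intro integral_mono integrable_min) auto
  also have "\<dots> = \<bar>t\<bar> * expectation (\<lambda>x. \<bar>X x\<bar>^3)" by simp
  also have "\<dots> \<le> 1" using third t by (meson abs_ge_zero mult_left_mono order_trans)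
  finally have *: "cmod (char (distr M borel X) t - (1 - t\<^sup>2 / 2)) \<le> t\<^sup>2 / 6"
    by (simp add: mult_left_mono)
  have "norm (complex_of_real (1 - t\<^sup>2 / 2)) = 1 - t\<^sup>2 / 2"
    unfolding norm_of_real using t2 by simp
  then have "norm (char (distr M borel X) t) \<le> t\<^sup>2 / 6 + (1 - t\<^sup>2 / 2)"
    using * norm_triangle_sub[of "char (distr M borel X) t" "complex_of_real (1 - t\<^sup>2 / 2)"] by simp
  also have "\<dots> = 1 + (- t\<^sup>2 / 3)" by simp
  also have "\<dots> \<le> exp (- t\<^sup>2 / 3)" by (rule exp_ge_add_one_self)
  finally show ?thesis .
qed

text \<open>The indicator of \<open>{y. \<bar>y - x\<bar> \<le> \<delta>}\<close> is at most \<open>2 exp (- ((y - x) / \<delta>)\<^sup>2 / 2)\<close>, and this Gaussian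
  is itself a characteristic function: exchanging the two integrals turns its expectation into an
  integral of the characteristic function of \<open>\<mu>\<close>.\<close>

lemma prob_interval_le_integral_char:
  assumes \<mu>: "real_distribution \<mu>" and \<delta>: "0 < \<delta>"
  shows "measure \<mu> {y. \<bar>y - x\<bar> \<le> \<delta>}
    \<le> 2 * (LINT u|std_normal_distribution. norm (char \<mu> (u / \<delta>)))"
proof -
  interpret \<mu>: real_distribution \<mu> by fact
  interpret \<gamma>: real_distribution std_normal_distribution by (rule real_dist_normal_dist)
  interpret P: pair_prob_space \<mu> std_normal_distribution ..
  have sets\<mu> [measurable_cong]: "sets \<mu> = sets borel" by simp
  define f where "f y u = iexp ((y - x) / \<delta> * u)" for y u
  have f_int: "integrable (\<mu> \<Otimes>\<^sub>M std_normal_distribution) (case_prod f)"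
    unfolding f_def by (rule P.integrable_const_bound[where B=1]) auto
  have gauss: "(CLINT u|std_normal_distribution. f y u)
      = complex_of_real (exp (- ((y - x) / \<delta>)\<^sup>2 / 2))" for y
    using fun_cong[OF char_std_normal_distribution, of "(y - x) / \<delta>"]
    unfolding f_def char_def by simp
  have inner: "(CLINT y|\<mu>. f y u) = iexp (- x / \<delta> * u) * char \<mu> (u / \<delta>)" for u
  proof -
    have "f y u = iexp (- x / \<delta> * u) * iexp (u / \<delta> * y)" for y
      unfolding f_def by (simp add: exp_add[symmetric] diff_divide_distrib algebra_simps)
    then show ?thesis unfolding char_def by simp
  qed
  have e2: "exp (1/2) \<le> (2::real)"
  proof -
    have "exp (1/2 :: real) \<le> 1 + 1/2 + (1/2)\<^sup>2" by (rule exp_bound) auto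
    then show ?thesis by (simp add: power2_eq_square)
  qed
  have ind: "indicator {y. \<bar>y - x\<bar> \<le> \<delta>} y \<le> 2 * exp (- ((y - x) / \<delta>)\<^sup>2 / 2)" for y :: real
  proof (cases "\<bar>y - x\<bar> \<le> \<delta>")
    case True
    then have "\<bar>(y - x) / \<delta>\<bar> \<le> 1" using \<delta> by simp
    then have "((y - x) / \<delta>)\<^sup>2 \<le> 1" by (simp add: abs_square_le_1)
    then have "exp (- (1/2)) \<le> exp (- ((y - x) / \<delta>)\<^sup>2 / 2)" by simp
    moreover have "1 \<le> 2 * exp (- (1/2)::real)" using e2 by (simp add: exp_minus field_simps)
    ultimately have "1 \<le> 2 * exp (- ((y - x) / \<delta>)\<^sup>2 / 2)" by linarith
    then show ?thesis by (simp split: split_indicator)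
  qed (simp add: indicator_def)
  have gi: "integrable \<mu> (\<lambda>y. exp (- ((y - x) / \<delta>)\<^sup>2 / 2))"
    by (rule \<mu>.integrable_const_bound[where B=1]) auto
  have "measure \<mu> {y. \<bar>y - x\<bar> \<le> \<delta>} = (LINT y|\<mu>. indicator {y. \<bar>y - x\<bar> \<le> \<delta>} y)"
    by simp
  also have "\<dots> \<le> (LINT y|\<mu>. 2 * exp (- ((y - x) / \<delta>)\<^sup>2 / 2))"
    using gi ind by (intro integral_mono) (auto intro!: \<mu>.integrable_const_bound[where B=1])
  also have "\<dots> = 2 * (LINT y|\<mu>. exp (- ((y - x) / \<delta>)\<^sup>2 / 2))" by simp
  also have "(LINT y|\<mu>. exp (- ((y - x) / \<delta>)\<^sup>2 / 2))
      = Re (CLINT y|\<mu>. (CLINT u|std_normal_distribution. f y u))"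
    unfolding gauss by simp
  also have "(CLINT y|\<mu>. (CLINT u|std_normal_distribution. f y u))
      = (CLINT u|std_normal_distribution. (CLINT y|\<mu>. f y u))"
    using P.Fubini_integral[OF f_int] by simp
  also have "Re \<dots> \<le> norm \<dots>" by (rule complex_Re_le_cmod)
  also have "\<dots> \<le> (LINT u|std_normal_distribution. norm (CLINT y|\<mu>. f y u))"
    by (rule integral_norm_bound)
  also have "\<dots> = (LINT u|std_normal_distribution. norm (char \<mu> (u / \<delta>)))"
    unfolding inner norm_mult by simp
  finally show ?thesis by simp
qed

lemma std_normal_prob_small:
  assumes "0 \<le> \<epsilon>"
  shows "measure std_normal_distribution {u. \<bar>u\<bar> \<le> \<epsilon>} \<le> 2 * \<epsilon>"
proof -
  have le1: "std_normal_density u \<le> 1" for u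
  proof -
    have "1 / sqrt (2 * pi) \<le> 1" using pi_gt3 by simp
    moreover have "exp (- u\<^sup>2 / 2) \<le> 1" by simp
    ultimately show ?thesis unfolding std_normal_density_def
      by (metis exp_ge_zero mult_le_one)
  qed
  have "emeasure std_normal_distribution {u. \<bar>u\<bar> \<le> \<epsilon>}
      = (\<integral>\<^sup>+u. ennreal (std_normal_density u) * indicator {u. \<bar>u\<bar> \<le> \<epsilon>} u \<partial>lborel)"
    by (rule emeasure_density) auto
  also have "\<dots> \<le> (\<integral>\<^sup>+u. indicator {-\<epsilon>..\<epsilon>} u \<partial>lborel)"
    using le1 by (intro nn_integral_mono) (auto split: split_indicator)
  also have "\<dots> = ennreal (2 * \<epsilon>)" using assms by simp
  finally show ?thesis using assms
    by (simp add: measure_def enn2real_leI)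
qed

lemma std_normal_prob_tail:
  assumes "0 < a"
  shows "measure std_normal_distribution {u. a \<le> \<bar>u\<bar>} \<le> 1 / a\<^sup>2"
proof -
  interpret \<gamma>: real_distribution std_normal_distribution by (rule real_dist_normal_dist)
  have "measure std_normal_distribution {u \<in> space std_normal_distribution. a\<^sup>2 \<le> u\<^sup>2}
      \<le> (LINT u|std_normal_distribution. u\<^sup>2) / a\<^sup>2"
    using assms integrable_std_normal_distribution_moment[of 2]
    by (intro integral_Markov_inequality_measure[where A="{}"]) auto
  also have "(LINT u|std_normal_distribution. u\<^sup>2) = 1"
    using std_normal_distribution_even_moments(1)[of 1] by simp
  also have "{u \<in> space std_normal_distribution. a\<^sup>2 \<le> u\<^sup>2} = {u. a \<le> \<bar>u\<bar>}"
    using assms by (auto simp: abs_le_square_iff[symmetric])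
  finally show ?thesis .
qed

section \<open>Weighted sums of independent variables of unit variance\<close>

text \<open>A finite independent family of centred random variables of variance 1 whose third absolute
  moments are at most \<open>B\<close>. Taking \<open>B \<ge> 1\<close> is no restriction: a nonempty family forces it, by the
  monotonicity of the moments.\<close>

locale unit_variance_family = prob_space +
  fixes G :: "'e \<Rightarrow> 'a \<Rightarrow> real" and P :: "'e set" and B :: real
  assumes fin: "finite P" and ind: "indep_vars (\<lambda>_. borel) G P"
    and mean: "\<And>e. e \<in> P \<Longrightarrow> expectation (G e) = 0"
    and var: "\<And>e. e \<in> P \<Longrightarrow> expectation (\<lambda>\<omega>. (G e \<omega>)\<^sup>2) = 1"
    and int3: "\<And>e. e \<in> P \<Longrightarrow> integrable M (\<lambda>\<omega>. \<bar>G e \<omega>\<bar> ^ 3)"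
    and third: "\<And>e. e \<in> P \<Longrightarrow> expectation (\<lambda>\<omega>. \<bar>G e \<omega>\<bar> ^ 3) \<le> B"
    and B: "1 \<le> B"
begin

lemma rv [measurable]: "e \<in> P \<Longrightarrow> random_variable borel (G e)"
  using ind by (auto simp: indep_vars_def)

lemma ind_subset: "D \<subseteq> P \<Longrightarrow> indep_vars (\<lambda>_. borel) G D"
  using ind by (rule indep_vars_subset)

lemma int1: assumes e: "e \<in> P" shows "integrable M (G e)"
proof (rule Bochner_Integration.integrable_bound)
  show "integrable M (\<lambda>\<omega>. 1 + \<bar>G e \<omega>\<bar> ^ 3)" using int3[OF e] by simp
  have "x \<le> 1 + x ^ 3" if "0 \<le> x" for x :: real
  proof (cases "x \<le> 1")
    case False
    then show ?thesis using power_increasing[of 1 3 x] by simp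
  qed (use that in \<open>simp add: add_increasing2\<close>)
  then show "AE \<omega> in M. norm (G e \<omega>) \<le> norm (1 + \<bar>G e \<omega>\<bar> ^ 3)" by simp
qed (use e in measurable)

lemma int2: assumes e: "e \<in> P" shows "integrable M (\<lambda>\<omega>. (G e \<omega>)\<^sup>2)"
proof (rule Bochner_Integration.integrable_bound)
  note [measurable] = rv[OF e]
  show "integrable M (\<lambda>\<omega>. 1 + \<bar>G e \<omega>\<bar> ^ 3)" using int3[OF e] by simp
  have "x\<^sup>2 \<le> 1 + \<bar>x\<bar> ^ 3" for x :: real
  proof (cases "\<bar>x\<bar> \<le> 1")
    case True
    then have "x\<^sup>2 \<le> 1" by (simp add: abs_square_le_1)
    then show ?thesis by (simp add: add_increasing2)
  next
    case False
    then have "\<bar>x\<bar>\<^sup>2 \<le> \<bar>x\<bar> ^ 3" by (intro power_increasing) auto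
    then show ?thesis by simp
  qed
  then show "AE \<omega> in M. norm ((G e \<omega>)\<^sup>2) \<le> norm (1 + \<bar>G e \<omega>\<bar> ^ 3)" by simp
  show "(\<lambda>\<omega>. (G e \<omega>)\<^sup>2) \<in> borel_measurable M" by measurable
qed

lemma norm_char_weighted_sum_le:
  assumes D: "D \<subseteq> P"
    and t: "\<And>e. e \<in> D \<Longrightarrow> \<bar>c e * t\<bar> * B \<le> 1"
  shows "norm (char (distr M borel (\<lambda>\<omega>. \<Sum>e\<in>D. c e * G e \<omega>)) t)
    \<le> exp (- (\<Sum>e\<in>D. (c e)\<^sup>2) * t\<^sup>2 / 3)"
proof -
  have rvD [measurable]: "\<And>e. e \<in> D \<Longrightarrow> random_variable borel (G e)"
    using D by (auto intro: rv)
  have "indep_vars (\<lambda>_. borel) (\<lambda>e \<omega>. c e * G e \<omega>) D"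
    by (rule indep_vars_compose2[OF ind_subset[OF D]]) simp
  from char_distr_sum[OF this, of t]
  have "norm (char (distr M borel (\<lambda>\<omega>. \<Sum>e\<in>D. c e * G e \<omega>)) t)
      = (\<Prod>e\<in>D. norm (char (distr M borel (\<lambda>\<omega>. c e * G e \<omega>)) t))"
    by (simp add: prod_norm)
  also have "\<dots> \<le> (\<Prod>e\<in>D. exp (- (c e * t)\<^sup>2 / 3))"
  proof (intro prod_mono conjI norm_ge_zero)
    fix e assume e: "e \<in> D"
    note [measurable] = rvD[OF e]
    have "char (distr M borel (\<lambda>\<omega>. c e * G e \<omega>)) t = char (distr M borel (G e)) (c e * t)"
      unfolding char_def by (simp add: integral_distr mult_ac)
    then show "norm (char (distr M borel (\<lambda>\<omega>. c e * G e \<omega>)) t) \<le> exp (- (c e * t)\<^sup>2 / 3)"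
      using norm_char_le_exp[OF rv int3 int1 int2 mean var third B t[OF e]] e D by auto
  qed
  also have "\<dots> = exp (\<Sum>e\<in>D. - (c e * t)\<^sup>2 / 3)" by (simp add: exp_sum finite_subset[OF D fin])
  also have "(\<Sum>e\<in>D. - (c e * t)\<^sup>2 / 3) = - (\<Sum>e\<in>D. (c e)\<^sup>2) * t\<^sup>2 / 3"
    by (simp add: sum_distrib_right sum_divide_distrib sum_negf power_mult_distrib)
  finally show ?thesis .
qed

text \<open>The three terms on the right come from the frequencies \<open>\<bar>u\<bar> \<le> \<epsilon>\<close>, from the moderate ones, where the
  characteristic function decays like a Gaussian, and from the Gaussian tail beyond \<open>\<delta> / (s B)\<close>, where
  nothing is known about the characteristic function.\<close>

lemma small_ball_weighted_sum:
  assumes D: "D \<subseteq> P"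
    and s: "0 < s" "\<And>e. e \<in> D \<Longrightarrow> \<bar>c e\<bar> \<le> s"
    and v: "v \<le> (\<Sum>e\<in>D. (c e)\<^sup>2)" "0 \<le> v" and \<delta>: "0 < \<delta>" and \<epsilon>: "0 < \<epsilon>"
  shows "prob {\<omega> \<in> space M. \<bar>(\<Sum>e\<in>D. c e * G e \<omega>) - x\<bar> \<le> \<delta>}
    \<le> 2 * (2 * \<epsilon> + exp (- v * (\<epsilon> / \<delta>)\<^sup>2 / 3) + (s * B / \<delta>)\<^sup>2)"
proof -
  have rvD [measurable]: "\<And>e. e \<in> D \<Longrightarrow> random_variable borel (G e)"
    using D by (auto intro: rv)
  define X where "X = (\<lambda>\<omega>. \<Sum>e\<in>D. c e * G e \<omega>)"
  have X [measurable]: "random_variable borel X" unfolding X_def by measurable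
  define \<mu> where "\<mu> = distr M borel X"
  interpret \<mu>: real_distribution \<mu> unfolding \<mu>_def by simp
  interpret \<gamma>: real_distribution std_normal_distribution by (rule real_dist_normal_dist)
  define a where "a = \<delta> / (s * B)"
  have a: "0 < a" using \<delta> s B by (simp add: a_def)
  let ?q = "exp (- v * (\<epsilon> / \<delta>)\<^sup>2 / 3)"
  have bound: "norm (char \<mu> (u / \<delta>))
      \<le> indicator {u. \<bar>u\<bar> \<le> \<epsilon>} u + ?q + indicator {u. a \<le> \<bar>u\<bar>} u" for u
  proof (cases "\<bar>u\<bar> \<le> \<epsilon> \<or> a \<le> \<bar>u\<bar>")
    case True
    have q: "0 \<le> ?q" by simp
    from True show ?thesis using \<mu>.cmod_char_le_1[of "u / \<delta>"] q
      by (auto split: split_indicator simp del: exp_ge_zero)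
  next
    case False
    have "norm (char \<mu> (u / \<delta>)) \<le> exp (- (\<Sum>e\<in>D. (c e)\<^sup>2) * (u / \<delta>)\<^sup>2 / 3)"
      unfolding \<mu>_def X_def
    proof (rule norm_char_weighted_sum_le[OF D])
      fix e assume "e \<in> D"
      have "\<bar>c e * (u / \<delta>)\<bar> * B \<le> s * (\<bar>u\<bar> / \<delta>) * B"
        unfolding abs_mult using s(2)[OF \<open>e \<in> D\<close>] \<delta> B
        by (intro mult_right_mono) (auto intro!: mult_mono divide_right_mono)
      also have "\<dots> \<le> s * (a / \<delta>) * B"
        using False s(1) \<delta> B by (intro mult_right_mono mult_left_mono divide_right_mono) auto
      also have "\<dots> = 1" using s(1) \<delta> B by (simp add: a_def)
      finally show "\<bar>c e * (u / \<delta>)\<bar> * B \<le> 1" .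
    qed
    also have "\<dots> \<le> ?q"
    proof -
      have "\<epsilon> / \<delta> \<le> \<bar>u / \<delta>\<bar>" using False \<delta> by (simp add: divide_right_mono)
      then have "(\<epsilon> / \<delta>)\<^sup>2 \<le> (u / \<delta>)\<^sup>2" using \<epsilon> \<delta> by (simp add: abs_le_square_iff[symmetric])
      then have "v * (\<epsilon> / \<delta>)\<^sup>2 \<le> (\<Sum>e\<in>D. (c e)\<^sup>2) * (u / \<delta>)\<^sup>2"
        using v by (intro mult_mono) auto
      then show ?thesis by simp
    qed
    finally show ?thesis using False by simp
  qed
  have [measurable]: "(\<lambda>u. char \<mu> (u / \<delta>)) \<in> borel_measurable borel"
    using measurable_compose[OF _ \<mu>.char_measurable] by measurable
  have ind_int1: "integrable std_normal_distribution (indicator {u. \<bar>u\<bar> \<le> \<epsilon>} :: real \<Rightarrow> real)"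
    and ind_int2: "integrable std_normal_distribution (indicator {u. a \<le> \<bar>u\<bar>} :: real \<Rightarrow> real)"
    by (auto intro!: \<gamma>.integrable_const_bound[where B=1])
  have "{\<omega> \<in> space M. \<bar>X \<omega> - x\<bar> \<le> \<delta>} = X -` {y. \<bar>y - x\<bar> \<le> \<delta>} \<inter> space M" by auto
  then have "prob {\<omega> \<in> space M. \<bar>X \<omega> - x\<bar> \<le> \<delta>} = measure \<mu> {y. \<bar>y - x\<bar> \<le> \<delta>}"
    unfolding \<mu>_def by (subst measure_distr) auto
  also have "\<dots> \<le> 2 * (LINT u|std_normal_distribution. norm (char \<mu> (u / \<delta>)))"
    by (rule prob_interval_le_integral_char[OF \<mu>.real_distribution_axioms \<delta>])
  also have "(LINT u|std_normal_distribution. norm (char \<mu> (u / \<delta>))) \<le>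
      (LINT u|std_normal_distribution. indicator {u. \<bar>u\<bar> \<le> \<epsilon>} u + ?q + indicator {u. a \<le> \<bar>u\<bar>} u)"
    using \<mu>.cmod_char_le_1
    by (intro integral_mono bound Bochner_Integration.integrable_add)
       (auto intro!: \<gamma>.integrable_const_bound[where B=1])
  also have "\<dots> = measure std_normal_distribution {u. \<bar>u\<bar> \<le> \<epsilon>} + ?q
      + measure std_normal_distribution {u. a \<le> \<bar>u\<bar>}"
    using ind_int1 ind_int2 \<gamma>.prob_space by simp
  also have "\<dots> \<le> 2 * \<epsilon> + ?q + 1 / a\<^sup>2"
    using std_normal_prob_small[of \<epsilon>] std_normal_prob_tail[OF a] \<epsilon> by simp
  also have "1 / a\<^sup>2 = (s * B / \<delta>)\<^sup>2" by (simp add: a_def power_divide)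
  finally show ?thesis by (simp add: X_def)
qed

lemma weighted_sum_moments:
  assumes D: "D \<subseteq> P"
  shows "integrable M (\<lambda>\<omega>. \<Sum>e\<in>D. c e * G e \<omega>)"
    and "expectation (\<lambda>\<omega>. \<Sum>e\<in>D. c e * G e \<omega>) = 0"
    and "integrable M (\<lambda>\<omega>. (\<Sum>e\<in>D. c e * G e \<omega>)\<^sup>2)"
    and "expectation (\<lambda>\<omega>. (\<Sum>e\<in>D. c e * G e \<omega>)\<^sup>2) = (\<Sum>e\<in>D. (c e)\<^sup>2)"
proof -
  have i1: "integrable M (\<lambda>\<omega>. \<Sum>e\<in>D. c e * G e \<omega>)" if "D \<subseteq> P" for D
    using that int1 by (auto intro!: Bochner_Integration.integrable_sum)
  have z: "expectation (\<lambda>\<omega>. \<Sum>e\<in>D. c e * G e \<omega>) = 0" if "D \<subseteq> P" for D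
    using that int1 mean by (subst Bochner_Integration.integral_sum) (auto intro!: sum.neutral)
  have "integrable M (\<lambda>\<omega>. (\<Sum>e\<in>D. c e * G e \<omega>)\<^sup>2) \<and>
    expectation (\<lambda>\<omega>. (\<Sum>e\<in>D. c e * G e \<omega>)\<^sup>2) = (\<Sum>e\<in>D. (c e)\<^sup>2)"
    using finite_subset[OF D fin] D
  proof (induction D rule: finite_induct)
    case empty
    then show ?case by simp
  next
    case (insert e D)
    let ?X = "\<lambda>\<omega>. c e * G e \<omega>" and ?S = "\<lambda>\<omega>. \<Sum>e\<in>D. c e * G e \<omega>"
    have e: "e \<in> P" and D: "D \<subseteq> P" using insert.prems by auto
    have "indep_vars (\<lambda>_. borel) (\<lambda>e \<omega>. c e * G e \<omega>) (insert e D)"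
      by (rule indep_vars_compose2[OF ind_subset[OF insert.prems]]) simp
    then have iv: "indep_var borel ?X borel ?S"
      by (rule indep_vars_sum[OF insert.hyps])
    have iX: "integrable M ?X" using int1[OF e] by simp
    have iP: "integrable M (\<lambda>\<omega>. ?X \<omega> * ?S \<omega>)"
      by (rule indep_var_integrable[OF iv iX i1[OF D]])
    have eP: "expectation (\<lambda>\<omega>. ?X \<omega> * ?S \<omega>) = 0"
      using indep_var_lebesgue_integral[OF iv iX i1[OF D]] mean[OF e] by simp
    have iX2: "integrable M (\<lambda>\<omega>. (?X \<omega>)\<^sup>2)"
      using int2[OF e] by (simp add: power_mult_distrib)
    have eX2: "expectation (\<lambda>\<omega>. (?X \<omega>)\<^sup>2) = (c e)\<^sup>2"
      using var[OF e] by (simp add: power_mult_distrib)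
    have eq: "(\<Sum>e\<in>insert e D. c e * G e \<omega>)\<^sup>2
        = (?X \<omega>)\<^sup>2 + (2 * (?X \<omega> * ?S \<omega>) + (?S \<omega>)\<^sup>2)" for \<omega>
      using insert.hyps by (simp add: power2_sum algebra_simps)
    from insert.IH[OF D] iX2 iP eP eX2 insert.hyps show ?case
      unfolding eq by (simp del: mult.assoc)
  qed
  then show "integrable M (\<lambda>\<omega>. (\<Sum>e\<in>D. c e * G e \<omega>)\<^sup>2)"
    "expectation (\<lambda>\<omega>. (\<Sum>e\<in>D. c e * G e \<omega>)\<^sup>2) = (\<Sum>e\<in>D. (c e)\<^sup>2)" by auto
  show "integrable M (\<lambda>\<omega>. \<Sum>e\<in>D. c e * G e \<omega>)"
    "expectation (\<lambda>\<omega>. \<Sum>e\<in>D. c e * G e \<omega>) = 0" using i1 z D by auto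
qed

lemma tail_weighted_sum:
  assumes D: "D \<subseteq> P" and r: "0 < r"
  shows "prob {\<omega> \<in> space M. r \<le> \<bar>\<Sum>e\<in>D. c e * G e \<omega>\<bar>} \<le> (\<Sum>e\<in>D. (c e)\<^sup>2) / r\<^sup>2"
proof -
  have [measurable]: "\<And>e. e \<in> D \<Longrightarrow> random_variable borel (G e)"
    using D by (auto intro: rv)
  have "random_variable borel (\<lambda>\<omega>. \<Sum>e\<in>D. c e * G e \<omega>)" by measurable
  from Chebyshev_inequality[OF this weighted_sum_moments(3)[OF D] r]
  show ?thesis using weighted_sum_moments[OF D, of c] by simp
qed

text \<open>Let \<open>X\<^sub>i\<close> and \<open>Y\<^sub>i\<close> be weighted sums over the blocks \<open>D\<^sub>i\<close> and \<open>Q\<^sub>i\<close>, where \<open>D\<^sub>i\<close> is disjoint from \<open>Q\<^sub>i\<close> and from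
  both blocks of every later index. Then the events \<open>(X\<^sub>i, Y\<^sub>i) \<in> S\<close>, though dependent, hold jointly with
  probability at most \<open>p\<^sup>n\<close>, \<open>n\<close> being the number of indices, as soon as each has probability at most
  \<open>p\<close> for every fixed value of \<open>Y\<^sub>i\<close>.\<close>

lemma prob_all_pairs_le_power:
  fixes c :: "'v \<Rightarrow> 'e \<Rightarrow> real" and D Q :: "'v \<Rightarrow> 'e set"
  defines "X \<equiv> \<lambda>i \<omega>. \<Sum>e\<in>D i. c i e * G e \<omega>"
    and "Y \<equiv> \<lambda>i \<omega>. \<Sum>e\<in>Q i. c i e * G e \<omega>"
  assumes sub: "\<And>i. i \<in> set xs \<Longrightarrow> D i \<subseteq> P" "\<And>i. i \<in> set xs \<Longrightarrow> Q i \<subseteq> P"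
    and DQ: "\<And>i. i \<in> set xs \<Longrightarrow> D i \<inter> Q i = {}"
    and later: "sorted_wrt (\<lambda>i k. D i \<inter> (D k \<union> Q k) = {}) xs"
    and S [measurable]: "S \<in> sets (borel \<Otimes>\<^sub>M borel)"
    and le: "\<And>i y. i \<in> set xs \<Longrightarrow> prob {\<omega> \<in> space M. (X i \<omega>, y) \<in> S} \<le> p"
    and p: "0 \<le> p"
  shows "prob {\<omega> \<in> space M. \<forall>i\<in>set xs. (X i \<omega>, Y i \<omega>) \<in> S} \<le> p ^ length xs"
  using sub DQ later le
proof (induction xs)
  case Nil
  then show ?case by simp
next
  case (Cons i xs)
  \<comment> \<open>\<open>X\<^sub>i\<close> depends on the block \<open>D\<^sub>i\<close> only; \<open>Y\<^sub>i\<close> and the event \<open>W\<close> for the later indices depend only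
    on the complement \<open>F\<close> of that block. So \<open>X\<^sub>i\<close> is independent of \<open>Z = (Y\<^sub>i, indicator W)\<close>.\<close>
  define F where "F = P - D i"
  have i: "D i \<subseteq> P" "Q i \<subseteq> F" and F: "F \<subseteq> P"
    using Cons.prems(1)[of i] Cons.prems(2)[of i] Cons.prems(3)[of i] by (auto simp: F_def)
  have FK: "D k \<subseteq> F" "Q k \<subseteq> F" if "k \<in> set xs" for k
    using that Cons.prems(1,2,4) by (auto simp: F_def)
  define \<Phi> where "\<Phi> = (\<lambda>f. ((\<Sum>e\<in>D i. c i e * f e :: real), 0 :: real))"
  define T where "T = {f. \<forall>k\<in>set xs. ((\<Sum>e\<in>D k. c k e * f e), (\<Sum>e\<in>Q k. c k e * f e)) \<in> S}"
  define \<Psi> where "\<Psi> = (\<lambda>f. ((\<Sum>e\<in>Q i. c i e * f e :: real), indicator T f :: real))"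
  let ?N = "PiM F (\<lambda>_. borel :: real measure)" and ?L = "PiM (D i) (\<lambda>_. borel :: real measure)"
  let ?R = "borel \<Otimes>\<^sub>M borel :: (real \<times> real) measure"
  have \<Phi>: "\<Phi> \<in> measurable ?L ?R" unfolding \<Phi>_def by measurable
  have lin [measurable]: "(\<lambda>f. \<Sum>e\<in>H. c k e * f e) \<in> borel_measurable ?N" if "H \<subseteq> F" for H k
    using that by (intro borel_measurable_sum borel_measurable_times measurable_component_singleton) auto
  have Tm: "{f \<in> space ?N. f \<in> T} \<in> sets ?N"
    unfolding T_def mem_Collect_eq
  proof (intro sets.sets_Collect_finite_All finite_set)
    fix k assume k: "k \<in> set xs"
    have [measurable]: "(\<lambda>f. \<Sum>e\<in>D k. c k e * f e) \<in> borel_measurable ?N"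
      "(\<lambda>f. \<Sum>e\<in>Q k. c k e * f e) \<in> borel_measurable ?N"
      using FK[OF k] by (auto intro: lin)
    show "{f \<in> space ?N. ((\<Sum>e\<in>D k. c k e * f e), (\<Sum>e\<in>Q k. c k e * f e)) \<in> S} \<in> sets ?N"
      by measurable
  qed
  have \<Psi>: "\<Psi> \<in> measurable ?N ?R"
    unfolding \<Psi>_def using i Tm
    by (intro measurable_Pair lin borel_measurable_indicator') (simp_all add: Int_def conj_commute vimage_def)
  define W where "W = {\<omega> \<in> space M. \<forall>k\<in>set xs. (X k \<omega>, Y k \<omega>) \<in> S}"
  define Z where "Z = (\<lambda>\<omega>. (Y i \<omega>, indicator W \<omega> :: real))"
  \<comment> \<open>Independence of two variables is formulated for a common type of values, whence the dummy
    second component.\<close>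
  define X' where "X' = (\<lambda>\<omega>. (X i \<omega>, 0 :: real))"
  have \<Phi>X: "(\<Phi> \<circ> (\<lambda>\<omega>. restrict (\<lambda>e. G e \<omega>) (D i))) = X'"
    by (simp add: \<Phi>_def X_def X'_def fun_eq_iff)
  have sums: "(\<Sum>e\<in>H. c k e * restrict (\<lambda>e. G e \<omega>) F e) = (\<Sum>e\<in>H. c k e * G e \<omega>)"
    if "H \<subseteq> F" for H k \<omega>
    using that by (intro sum.cong) auto
  have \<Psi>Z: "(\<Psi> \<circ> (\<lambda>\<omega>. restrict (\<lambda>e. G e \<omega>) F)) \<omega> = Z \<omega>" if "\<omega> \<in> space M" for \<omega>
    using that i FK
    by (auto simp: \<Psi>_def Z_def Y_def X_def T_def W_def sums indicator_def simp del: restrict_apply)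
  have "indep_var ?R (\<Phi> \<circ> (\<lambda>\<omega>. restrict (\<lambda>e. G e \<omega>) (D i)))
      ?R (\<Psi> \<circ> (\<lambda>\<omega>. restrict (\<lambda>e. G e \<omega>) F))"
    by (rule indep_var_compose[OF indep_var_restrict[OF ind] \<Phi> \<Psi>]) (use i F in \<open>auto simp: F_def\<close>)
  then have joint: "random_variable ?R X'" "random_variable ?R Z"
    "distr M ?R X' \<Otimes>\<^sub>M distr M ?R Z =
      distr M (?R \<Otimes>\<^sub>M ?R) (\<lambda>\<omega>. (X' \<omega>, Z \<omega>))"
    unfolding indep_var_distribution_eq \<Phi>X using \<Psi>Z
    by (simp_all cong: measurable_cong distr_cong)
  note [measurable] = joint(1,2)
  interpret dX: prob_space "distr M ?R X'" by (rule prob_space_distr) measurable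
  interpret dZ: prob_space "distr M ?R Z" by (rule prob_space_distr) measurable
  interpret XZ: pair_prob_space "distr M ?R X'" "distr M ?R Z" ..
  \<comment> \<open>Fubini for the joint law: for each value of \<open>Z\<close> the section in \<open>X\<^sub>i\<close> has probability at most
    \<open>p\<close> on \<open>W\<close>, and is empty off \<open>W\<close>.\<close>
  define V where "V = {z :: (real \<times> real) \<times> (real \<times> real). (fst (fst z), fst (snd z)) \<in> S \<and> snd (snd z) = 1}"
  have "{z \<in> space (?R \<Otimes>\<^sub>M ?R). (fst (fst z), fst (snd z)) \<in> S \<and> snd (snd z) = (1::real)}
      \<in> sets (?R \<Otimes>\<^sub>M ?R)"
    by measurable
  then have V [measurable]: "V \<in> sets (?R \<Otimes>\<^sub>M ?R)"
    by (simp add: V_def space_pair_measure)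
  have sub': "D k \<subseteq> P" "Q k \<subseteq> P" if "k \<in> set xs" for k
    using FK[OF that] F by auto
  have W: "W \<in> sets M"
    unfolding W_def
  proof (intro sets.sets_Collect_finite_All finite_set)
    fix k assume k: "k \<in> set xs"
    have [measurable]: "random_variable borel (G e)" if "e \<in> D k \<union> Q k" for e
      using that sub'[OF k] by (auto intro: rv)
    have [measurable]: "random_variable borel (X k)" "random_variable borel (Y k)"
      unfolding X_def Y_def by measurable
    show "{\<omega> \<in> space M. (X k \<omega>, Y k \<omega>) \<in> S} \<in> sets M" by measurable
  qed
  define U where "U = {z :: real \<times> real. snd z = 1}"
  have "{z \<in> space ?R. snd z = (1::real)} \<in> sets ?R"
    by measurable
  then have U [measurable]: "U \<in> sets ?R"
    by (simp add: U_def space_pair_measure)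
  have "emeasure M {\<omega> \<in> space M. \<forall>k\<in>set (i # xs). (X k \<omega>, Y k \<omega>) \<in> S}
      = emeasure M ((\<lambda>\<omega>. (X' \<omega>, Z \<omega>)) -` V \<inter> space M)"
    by (intro arg_cong[where f="emeasure M"]) (auto simp: V_def Z_def X'_def W_def indicator_def)
  also have "\<dots> = emeasure (distr M ?R X' \<Otimes>\<^sub>M distr M ?R Z) V"
    unfolding joint(3) by (rule emeasure_distr[symmetric]) measurable
  also have "\<dots> = (\<integral>\<^sup>+z. emeasure (distr M ?R X') ((\<lambda>x. (x, z)) -` V)
      \<partial>distr M ?R Z)"
    by (rule XZ.emeasure_pair_measure_alt2) (simp cong: sets_pair_measure_cong)
  also have "\<dots> \<le> (\<integral>\<^sup>+z. ennreal p * indicator U z \<partial>distr M ?R Z)"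
  proof (rule nn_integral_mono)
    fix z
    show "emeasure (distr M ?R X') ((\<lambda>x. (x, z)) -` V) \<le> ennreal p * indicator U z"
    proof (cases "z \<in> U")
      case True
      have eq: "(\<lambda>x. (x, z)) -` V = {x. (fst x, fst z) \<in> S}"
        using True by (auto simp: V_def U_def)
      have "{x \<in> space ?R. (fst x, fst z) \<in> S} \<in> sets ?R" by measurable
      then have m: "{x. (fst x, fst z) \<in> S} \<in> sets ?R" by (simp add: space_pair_measure)
      have "emeasure (distr M ?R X') {x. (fst x, fst z) \<in> S}
          = emeasure M (X' -` {x. (fst x, fst z) \<in> S} \<inter> space M)"
        by (rule emeasure_distr[OF _ m]) measurable
      also have "X' -` {x. (fst x, fst z) \<in> S} \<inter> space M = {\<omega> \<in> space M. (X i \<omega>, fst z) \<in> S}"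
        by (auto simp: X'_def)
      also have "emeasure M \<dots> \<le> ennreal p"
        using Cons.prems(5)[of i "fst z"] by (simp add: emeasure_eq_measure ennreal_leI)
      finally show ?thesis using True eq by simp
    next
      case False
      then have "(\<lambda>x. (x, z)) -` V = {}" by (auto simp: V_def U_def)
      then show ?thesis by simp
    qed
  qed
  also have "\<dots> = ennreal p * emeasure (distr M ?R Z) U"
    by (simp add: nn_integral_cmult_indicator)
  also have "emeasure (distr M ?R Z) U = emeasure M (Z -` U \<inter> space M)"
    by (rule emeasure_distr) measurable
  also have "Z -` U \<inter> space M = W"
    using sets.sets_into_space[OF W] by (auto simp: Z_def U_def indicator_def)
  also have "ennreal p * emeasure M W \<le> ennreal p * ennreal (p ^ length xs)"
  proof (rule mult_left_mono)
    have "prob W \<le> p ^ length xs" unfolding W_def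
      using Cons.prems by (intro Cons.IH) auto
    then show "emeasure M W \<le> ennreal (p ^ length xs)"
      by (simp add: emeasure_eq_measure ennreal_leI)
  qed simp
  also have "\<dots> = ennreal (p ^ length (i # xs))" using p by (simp add: ennreal_mult)
  finally show ?case using p
    by (simp add: emeasure_eq_measure)
qed

end

section \<open>Degrees and the splitting of the local fields\<close>

text \<open>The edges as ordered pairs with the larger endpoint first, which matches the index set of the
  independent entries below the diagonal.\<close>

definition edge_pairs :: "nat \<Rightarrow> nat set set \<Rightarrow> (nat \<times> nat) set" where
  "edge_pairs N E = {(i, j). i \<in> {1..N} \<and> j \<in> {1..N} \<and> j < i \<and> {i, j} \<in> E}"

text \<open>The edges from \<open>i\<close> to smaller vertices, that is, the part of row \<open>i\<close> of the strict lower
  triangle that lies on edges.\<close>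

definition lower :: "nat \<Rightarrow> nat set set \<Rightarrow> nat \<Rightarrow> (nat \<times> nat) set" where
  "lower N E i = {e \<in> edge_pairs N E. fst e = i}"

text \<open>The edges from \<open>i\<close> to larger vertices, that is, the part of column \<open>i\<close> of the strict lower
  triangle that lies on edges.\<close>

definition upper :: "nat \<Rightarrow> nat set set \<Rightarrow> nat \<Rightarrow> (nat \<times> nat) set" where
  "upper N E i = {e \<in> edge_pairs N E. snd e = i}"

lemma edge_pairs_fst_snd:
  "e \<in> edge_pairs N E \<Longrightarrow> fst e \<in> {1..N} \<and> snd e \<in> {1..N} \<and> snd e < fst e"
  by (auto simp: edge_pairs_def)

lemma finite_edge_pairs [simp]: "finite (edge_pairs N E)"
  by (rule finite_subset[of _ "{1..N} \<times> {1..N}"]) (auto simp: edge_pairs_def)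

lemma lower_subset: "lower N E i \<subseteq> edge_pairs N E" and upper_subset: "upper N E i \<subseteq> edge_pairs N E"
  by (auto simp: lower_def upper_def)

lemma finite_lower [simp]: "finite (lower N E i)" and finite_upper [simp]: "finite (upper N E i)"
  by (auto simp: lower_def upper_def)

lemma lower_upper_disjoint: "lower N E i \<inter> upper N E i = {}"
  by (auto simp: lower_def upper_def dest: edge_pairs_fst_snd)

lemma bij_betw_edge_pairs:
  assumes "simple_graph N E"
  shows "bij_betw (\<lambda>e. {fst e, snd e}) (edge_pairs N E) E"
proof (rule bij_betwI')
  fix e f assume "e \<in> edge_pairs N E" "f \<in> edge_pairs N E"
  then show "({fst e, snd e} = {fst f, snd f}) = (e = f)"
    using edge_pairs_fst_snd[of e N E] edge_pairs_fst_snd[of f N E]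
    by (auto simp: doubleton_eq_iff prod_eq_iff)
next
  fix e assume "e \<in> edge_pairs N E"
  then show "{fst e, snd e} \<in> E" by (auto simp: edge_pairs_def)
next
  fix e assume e: "e \<in> E"
  then have "card e = 2" and sub: "e \<subseteq> {1..N}" using assms by (auto simp: simple_graph_def)
  then obtain a b where ab: "e = {a, b}" "a \<noteq> b" by (auto simp: card_2_iff)
  show "\<exists>f\<in>edge_pairs N E. e = {fst f, snd f}"
  proof (cases "b < a")
    case True
    then show ?thesis using ab e sub by (intro bexI[of _ "(a, b)"]) (auto simp: edge_pairs_def)
  next
    case False
    then show ?thesis using ab e sub
      by (intro bexI[of _ "(b, a)"]) (auto simp: edge_pairs_def insert_commute)
  qed
qed

lemma degree_eq_lower_upper:
  assumes "simple_graph N E"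
  shows "degree E i = card (lower N E i) + card (upper N E i)"
proof -
  let ?f = "\<lambda>e. {fst e, snd e}"
  have inj: "inj_on ?f (edge_pairs N E)" and im: "?f ` edge_pairs N E = E"
    using bij_betw_edge_pairs[OF assms] by (auto simp: bij_betw_def)
  have "{e \<in> E. i \<in> e} = ?f ` (lower N E i \<union> upper N E i)"
    unfolding lower_def upper_def by (subst im[symmetric]) auto
  then have "degree E i = card (lower N E i \<union> upper N E i)"
    unfolding degree_def using inj lower_subset upper_subset
    by (simp add: card_image inj_on_subset)
  then show ?thesis using lower_upper_disjoint by (simp add: card_Un_disjoint)
qed

lemma sum_degree:
  assumes "simple_graph N E"
  shows "(\<Sum>i=1..N. degree E i) = 2 * card E"
proof -
  have "(\<Sum>i=1..N. card (lower N E i)) = card (edge_pairs N E)"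
    using sum.group[of "edge_pairs N E" "{1..N}" fst "\<lambda>_. 1::nat"] edge_pairs_fst_snd[of _ N E]
    unfolding lower_def by (simp add: image_subset_iff)
  moreover have "(\<Sum>i=1..N. card (upper N E i)) = card (edge_pairs N E)"
    using sum.group[of "edge_pairs N E" "{1..N}" snd "\<lambda>_. 1::nat"] edge_pairs_fst_snd[of _ N E]
    unfolding upper_def by (simp add: image_subset_iff)
  moreover have "card (edge_pairs N E) = card E"
    by (rule bij_betw_same_card[OF bij_betw_edge_pairs[OF assms]])
  ultimately show ?thesis by (simp add: degree_eq_lower_upper[OF assms] sum.distrib)
qed

lemma degree_le:
  assumes "i \<in> {1..N}" "real (max_degree N E) \<le> D"
  shows "real (degree E i) \<le> D"
proof -
  have "degree E i \<le> max_degree N E" unfolding max_degree_def using assms by (intro Max_ge) auto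
  then show ?thesis using assms by linarith
qed

text \<open>Vertices of degree at least half the average degree \<open>d\<close> number at least \<open>N / (2 C)\<close>, because the others
  contribute at most half of the sum of the degrees and no degree exceeds \<open>C d\<close>. Each of them has
  \<open>d / 4\<close> edges on one side.\<close>

lemma many_large_blocks:
  assumes g: "simple_graph N E" and d: "0 < avg_degree N E" and C: "0 < C"
    and max: "real (max_degree N E) \<le> C * avg_degree N E"
  defines "A \<equiv> {i \<in> {1..N}. avg_degree N E / 4 \<le> card (lower N E i)}"
    and "A' \<equiv> {i \<in> {1..N}. avg_degree N E / 4 \<le> card (upper N E i)}"
  shows "real N / (4 * C) \<le> card A \<or> real N / (4 * C) \<le> card A'"
proof -
  let ?d = "avg_degree N E"
  have N: "0 < N" using d by (cases N) (auto simp: avg_degree_def)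
  define H where "H = {i \<in> {1..N}. ?d / 2 \<le> degree E i}"
  have "real N * ?d = (\<Sum>i=1..N. real (degree E i))"
    using sum_degree[OF g] N by (simp add: avg_degree_def of_nat_sum[symmetric] del: of_nat_sum)
  also have "\<dots> = (\<Sum>i\<in>H. real (degree E i)) + (\<Sum>i\<in>{1..N} - H. real (degree E i))"
    by (subst add.commute, rule sum.subset_diff) (auto simp: H_def)
  also have "\<dots> \<le> (\<Sum>i\<in>H. C * ?d) + (\<Sum>i\<in>{1..N} - H. ?d / 2)"
    using degree_le[OF _ max] by (intro add_mono sum_mono) (auto simp: H_def)
  also have "\<dots> = card H * (C * ?d) + card ({1..N} - H) * (?d / 2)" by simp
  also have "\<dots> \<le> card H * (C * ?d) + N * (?d / 2)"
  proof -
    have "card ({1..N} - H) \<le> N" using card_mono[of "{1..N}" "{1..N} - H"] by simp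
    then show ?thesis using d by simp
  qed
  finally have "(real N / 2) * ?d \<le> (card H * C) * ?d" by (simp add: algebra_simps)
  then have "real N / 2 \<le> card H * C" using d by simp
  then have 1: "real N / (2 * C) \<le> card H" using C by (simp add: field_simps)
  have "H \<subseteq> A \<union> A'" unfolding H_def A_def A'_def degree_eq_lower_upper[OF g] by auto
  then have "card H \<le> card (A \<union> A')" by (intro card_mono) (auto simp: A_def A'_def)
  also have "\<dots> \<le> card A + card A'" by (rule card_Un_le)
  finally have "real (card H) \<le> card A + card A'" by linarith
  moreover have "real N / (2 * C) = real N / (4 * C) + real N / (4 * C)" by simp
  ultimately show ?thesis using 1 by linarith
qed

text \<open>The coefficient with which the entry at the edge \<open>e\<close>, incident to \<open>i\<close>, enters the local field
  at \<open>i\<close>: the spin at the other endpoint, normalised. For edges not incident to \<open>i\<close> the value is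
  irrelevant.\<close>

definition weight :: "nat \<Rightarrow> nat set set \<Rightarrow> (nat \<Rightarrow> real) \<Rightarrow> nat \<Rightarrow> nat \<times> nat \<Rightarrow> real" where
  "weight N E \<sigma> i e = \<sigma> (if fst e = i then snd e else fst e) / sqrt (avg_degree N E)"

lemma local_field_split:
  assumes g: "simple_graph N E" and i: "i \<in> {1..N}"
    and sym: "\<And>j. j \<in> {1..N} \<Longrightarrow> G i j = G j i"
  shows "local_field N (coupling N E G) \<sigma> i =
    (\<Sum>e\<in>lower N E i. weight N E \<sigma> i e * G (fst e) (snd e)) +
    (\<Sum>e\<in>upper N E i. weight N E \<sigma> i e * G (fst e) (snd e))"
proof -
  let ?t = "\<lambda>j. G i j * \<sigma> j / sqrt (avg_degree N E)"
  have notin: "{i, i} \<notin> E" using g by (auto simp: simple_graph_def)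
  have "local_field N (coupling N E G) \<sigma> i = (\<Sum>j\<in>{1..N}. if {i, j} \<in> E then ?t j else 0)"
    unfolding local_field_def coupling_def adj_mat_def by (intro sum.cong) auto
  also have "\<dots> = (\<Sum>j\<in>{j \<in> {1..N}. {i, j} \<in> E}. ?t j)"
    by (rule sum.inter_filter[symmetric]) simp
  also have "{j \<in> {1..N}. {i, j} \<in> E} =
      {j \<in> {1..N}. {i, j} \<in> E \<and> j < i} \<union> {j \<in> {1..N}. {i, j} \<in> E \<and> i < j}"
    using notin by auto (metis insert_absorb2 linorder_neqE_nat)
  also have "(\<Sum>j\<in>\<dots>. ?t j) = (\<Sum>j\<in>{j \<in> {1..N}. {i, j} \<in> E \<and> j < i}. ?t j) +
      (\<Sum>j\<in>{j \<in> {1..N}. {i, j} \<in> E \<and> i < j}. ?t j)"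
    by (rule sum.union_disjoint) auto
  also have "(\<Sum>j\<in>{j \<in> {1..N}. {i, j} \<in> E \<and> j < i}. ?t j) =
      (\<Sum>e\<in>lower N E i. weight N E \<sigma> i e * G (fst e) (snd e))"
    using i by (intro sum.reindex_bij_witness[of _ snd "\<lambda>j. (i, j)"])
      (auto simp: lower_def edge_pairs_def weight_def)
  also have "(\<Sum>j\<in>{j \<in> {1..N}. {i, j} \<in> E \<and> i < j}. ?t j) =
      (\<Sum>e\<in>upper N E i. weight N E \<sigma> i e * G (fst e) (snd e))"
    using i sym by (intro sum.reindex_bij_witness[of _ fst "\<lambda>j. (j, i)"])
      (auto simp: upper_def edge_pairs_def weight_def insert_commute)
  finally show ?thesis .
qed

section \<open>Small values of the quadratic form\<close>

text \<open>Otherwise more than half of the vertices of \<open>S\<close> have \<open>\<bar>m\<^sub>i\<bar> \<le> R\<close>, and each of these is farther than \<open>\<delta>\<close>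
  from at least a quarter of \<open>S\<close> among them, which makes the double sum at least
  \<open>(\<tau> * \<delta> * card S)\<^sup>2 / 8\<close>.\<close>

lemma concentrated_or_large:
  fixes m \<theta> :: "nat \<Rightarrow> real"
  assumes S: "S \<subseteq> {1..N}" and \<theta>: "\<And>i. 0 \<le> \<theta> i" "\<And>i. \<bar>m i\<bar> \<le> R \<Longrightarrow> \<tau> \<le> \<theta> i"
    and \<tau>: "0 \<le> \<tau>" and \<delta>: "0 \<le> \<delta>"
    and small: "(\<Sum>i=1..N. \<Sum>j=1..N. \<theta> i * \<theta> j * (m i - m j)\<^sup>2) < (\<tau> * \<delta> * card S)\<^sup>2 / 8"
  shows "card S \<le> 2 * card {i \<in> S. R < \<bar>m i\<bar>} \<or>
    (\<exists>j\<in>S. \<bar>m j\<bar> \<le> R \<and> card S \<le> 4 * card {i \<in> S. \<bar>m i - m j\<bar> \<le> \<delta>})"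
proof (rule ccontr)
  assume contr: "\<not> ?thesis"
  have fS: "finite S" using S finite_subset by blast
  define I where "I = {i \<in> S. \<bar>m i\<bar> \<le> R}"
  define F where "F j = {i \<in> I. \<delta> < \<bar>m j - m i\<bar>}" for j
  have fI: "finite I" using fS by (simp add: I_def)
  have fF: "finite (F j)" for j using fI by (simp add: F_def)
  have "S = I \<union> {i \<in> S. R < \<bar>m i\<bar>}" by (auto simp: I_def)
  then have "card S \<le> card I + card {i \<in> S. R < \<bar>m i\<bar>}" by (metis card_Un_le)
  with contr have I2: "card S \<le> 2 * card I" by auto
  have F4: "card S \<le> 4 * card (F j)" if j: "j \<in> I" for j
  proof -
    have "I \<subseteq> F j \<union> {i \<in> S. \<bar>m i - m j\<bar> \<le> \<delta>}" by (auto simp: F_def I_def abs_minus_commute)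
    then have "card I \<le> card (F j \<union> {i \<in> S. \<bar>m i - m j\<bar> \<le> \<delta>})"
      using fF fS by (intro card_mono) auto
    also have "\<dots> \<le> card (F j) + card {i \<in> S. \<bar>m i - m j\<bar> \<le> \<delta>}" by (rule card_Un_le)
    finally have "card I \<le> card (F j) + card {i \<in> S. \<bar>m i - m j\<bar> \<le> \<delta>}" .
    moreover have "4 * card {i \<in> S. \<bar>m i - m j\<bar> \<le> \<delta>} < card S"
      using contr j by (auto simp: I_def not_le)
    ultimately show ?thesis using I2 by linarith
  qed
  have "(\<tau> * \<delta> * card S)\<^sup>2 / 8 = (real (card S) / 2) * ((real (card S) / 4) * (\<tau> * \<tau> * \<delta>\<^sup>2))"
    by (simp add: power2_eq_square)
  also have "\<dots> \<le> real (card I) * ((real (card S) / 4) * (\<tau> * \<tau> * \<delta>\<^sup>2))"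
    using I2 \<tau> by (intro mult_right_mono) auto
  also have "\<dots> = (\<Sum>j\<in>I. (real (card S) / 4) * (\<tau> * \<tau> * \<delta>\<^sup>2))" by simp
  also have "\<dots> \<le> (\<Sum>j\<in>I. \<Sum>i\<in>F j. \<tau> * \<tau> * \<delta>\<^sup>2)"
  proof (intro sum_mono)
    fix j assume "j \<in> I"
    then have "real (card S) / 4 \<le> real (card (F j))" using F4[of j] by linarith
    then show "(real (card S) / 4) * (\<tau> * \<tau> * \<delta>\<^sup>2) \<le> (\<Sum>i\<in>F j. \<tau> * \<tau> * \<delta>\<^sup>2)"
      unfolding sum_constant using \<tau> by (intro mult_right_mono) auto
  qed
  also have "\<dots> \<le> (\<Sum>j\<in>I. \<Sum>i\<in>F j. \<theta> j * \<theta> i * (m j - m i)\<^sup>2)"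
  proof (intro sum_mono mult_mono)
    fix j i assume "j \<in> I" "i \<in> F j"
    then have "\<bar>\<delta>\<bar> \<le> \<bar>m j - m i\<bar>" using \<delta> by (auto simp: F_def)
    then show "\<delta>\<^sup>2 \<le> (m j - m i)\<^sup>2" by (simp add: abs_le_square_iff)
  qed (use \<theta> \<tau> in \<open>auto simp: F_def I_def\<close>)
  also have "\<dots> \<le> (\<Sum>j\<in>I. \<Sum>i=1..N. \<theta> j * \<theta> i * (m j - m i)\<^sup>2)"
    using \<theta> S by (intro sum_mono sum_mono2) (auto simp: F_def I_def)
  also have "\<dots> \<le> (\<Sum>j=1..N. \<Sum>i=1..N. \<theta> j * \<theta> i * (m j - m i)\<^sup>2)"
    using \<theta> S by (intro sum_mono2 sum_nonneg) (auto simp: F_def I_def)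
  finally show False using small by simp
qed

lemma exists_grid_point:
  fixes x R \<delta> :: real
  assumes "0 < \<delta>" "\<bar>x\<bar> \<le> R"
  shows "\<exists>k\<in>{- (\<lceil>R / \<delta>\<rceil> + 1)..\<lceil>R / \<delta>\<rceil> + 1}. \<bar>x - of_int k * \<delta>\<bar> \<le> \<delta>"
proof
  let ?k = "\<lfloor>x / \<delta>\<rfloor>"
  have "- (R / \<delta>) \<le> x / \<delta>" "x / \<delta> \<le> R / \<delta>"
    using assms by (auto simp: field_simps)
  then show "?k \<in> {- (\<lceil>R / \<delta>\<rceil> + 1)..\<lceil>R / \<delta>\<rceil> + 1}"
    by simp linarith
  have "of_int ?k \<le> x / \<delta>" "x / \<delta> \<le> of_int ?k + 1" by linarith+
  then have "of_int ?k * \<delta> \<le> x" "x \<le> (of_int ?k + 1) * \<delta>"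
    using assms by (simp_all only: pos_le_divide_eq pos_divide_le_eq)
  then have "of_int ?k * \<delta> \<le> x" "x \<le> of_int ?k * \<delta> + \<delta>"
    by (simp_all add: distrib_right)
  then show "\<bar>x - of_int ?k * \<delta>\<bar> \<le> \<delta>" by linarith
qed

lemma theta_ge:
  assumes "0 \<le> \<beta>" "\<bar>local_field N J \<sigma> i\<bar> \<le> R"
  shows "(sech (\<beta> * R + \<bar>h\<bar>))\<^sup>2 \<le> theta \<beta> h N J \<sigma> i"
proof -
  let ?x = "\<beta> * local_field N J \<sigma> i + h"
  have "\<bar>?x\<bar> \<le> \<bar>\<beta> * local_field N J \<sigma> i\<bar> + \<bar>h\<bar>" by (rule abs_triangle_ineq)
  also have "\<dots> \<le> \<beta> * R + \<bar>h\<bar>" using assms by (simp add: abs_mult mult_left_mono)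
  finally have le: "\<bar>?x\<bar> \<le> \<beta> * R + \<bar>h\<bar>" .
  then have "cosh \<bar>?x\<bar> \<le> cosh (\<beta> * R + \<bar>h\<bar>)"
    by (subst cosh_real_nonneg_le_iff) auto
  then have "cosh ?x \<le> cosh (\<beta> * R + \<bar>h\<bar>)" by simp
  then show ?thesis unfolding theta_def sech_def
    by (intro power_mono frac_le) (auto simp: cosh_real_pos)
qed

section \<open>The probability of a small minimum\<close>

text \<open>Rows are processed in increasing order and columns in decreasing order: row \<open>i\<close> of the strict lower
  triangle meets no row or column of a larger index, and column \<open>i\<close> meets none of a smaller index.\<close>

lemma prob_all_vertices_le_power:
  fixes c :: "nat \<Rightarrow> nat \<times> nat \<Rightarrow> real" and T :: "(real \<times> real) set"
  assumes "unit_variance_family M G (edge_pairs N E) B"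
    and DQ: "(D, Q) = (lower N E, upper N E) \<or> (D, Q) = (upper N E, lower N E)"
    and I: "finite I" and T: "T \<in> sets (borel \<Otimes>\<^sub>M borel)" and p: "0 \<le> p"
    and le: "\<And>i y. i \<in> I \<Longrightarrow>
      measure M {\<omega> \<in> space M. ((\<Sum>e\<in>D i. c i e * G e \<omega>), y) \<in> T} \<le> p"
  shows "measure M {\<omega> \<in> space M. \<forall>i\<in>I.
    ((\<Sum>e\<in>D i. c i e * G e \<omega>), (\<Sum>e\<in>Q i. c i e * G e \<omega>)) \<in> T} \<le> p ^ card I"
proof -
  interpret unit_variance_family M G "edge_pairs N E" B by fact
  obtain xs where xs: "set xs = I" "length xs = card I"
    and later: "sorted_wrt (\<lambda>i k. D i \<inter> (D k \<union> Q k) = {}) xs"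
  proof -
    let ?l = "sorted_list_of_set I"
    have l: "sorted_wrt (<) ?l" "set ?l = I" "length ?l = card I" using I by auto
    from DQ show thesis
    proof
      assume DQ: "(D, Q) = (lower N E, upper N E)"
      have "sorted_wrt (\<lambda>i k. D i \<inter> (D k \<union> Q k) = {}) ?l"
        by (rule sorted_wrt_mono_rel[OF _ l(1)])
          (use DQ in \<open>auto simp: lower_def upper_def dest: edge_pairs_fst_snd\<close>)
      then show thesis using l that by blast
    next
      assume DQ: "(D, Q) = (upper N E, lower N E)"
      have "sorted_wrt (\<lambda>i k. D k \<inter> (D i \<union> Q i) = {}) ?l"
        by (rule sorted_wrt_mono_rel[OF _ l(1)])
          (use DQ in \<open>auto simp: lower_def upper_def dest: edge_pairs_fst_snd\<close>)
      then show thesis using l that[of "rev ?l"] by (simp add: sorted_wrt_rev)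
    qed
  qed
  have "D i \<subseteq> edge_pairs N E" "Q i \<subseteq> edge_pairs N E" "D i \<inter> Q i = {}" for i
    using DQ lower_subset[of N E i] upper_subset[of N E i] lower_upper_disjoint[of N E i] by auto
  from prob_all_pairs_le_power[of xs D Q T c p, OF this later T _ p] le
  show ?thesis unfolding xs by blast
qed

text \<open>The union bound for a single \<open>N\<close>. The parameter \<open>p\<close> bounds both probabilities at a
  single vertex, the one of a large half field and the one of a ball of radius \<open>2 \<delta>\<close>.\<close>

lemma prob_T_tilde_small_le:
  fixes M :: "'a measure" and g :: "nat \<Rightarrow> nat \<Rightarrow> 'a \<Rightarrow> real" and p R \<delta> \<epsilon> C :: real
  defines "\<Gamma> \<equiv> {- (\<lceil>R / \<delta>\<rceil> + 1)..\<lceil>R / \<delta>\<rceil> + 1}"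
  assumes U: "unit_variance_family M (\<lambda>e. g (fst e) (snd e)) (edge_pairs N E) B"
    and graph: "simple_graph N E" and N: "1 \<le> N"
    and sym: "\<And>i j \<omega>. i \<in> {1..N} \<Longrightarrow> j \<in> {1..N} \<Longrightarrow> \<omega> \<in> space M \<Longrightarrow> g i j \<omega> = g j i \<omega>"
    and \<beta>: "0 \<le> \<beta>" and C: "0 < C" and p: "0 < p" "p \<le> 1" and R: "0 < R"
    and \<delta>: "0 < \<delta>" and \<epsilon>: "0 < \<epsilon>" and d: "0 < avg_degree N E"
    and max: "real (max_degree N E) \<le> C * avg_degree N E"
    and Rp: "4 * C / R\<^sup>2 \<le> p"
    and ball: "2 * (2 * \<epsilon> + exp (- (1/4) * (\<epsilon> / (2 * \<delta>))\<^sup>2 / 3)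
      + (1 / sqrt (avg_degree N E) * B / (2 * \<delta>))\<^sup>2) \<le> p"
    and c0: "c0 < ((sech (\<beta> * R + \<bar>h\<bar>))\<^sup>2 * \<delta> / (4 * C))\<^sup>2 / 8"
  shows "measure M {\<omega> \<in> space M.
      Min (T_tilde \<beta> h N (coupling N E (\<lambda>i j. g i j \<omega>)) ` spins N) \<le> c0}
    \<le> (2 + real (card \<Gamma>)) * 4 ^ N * p powr (real N / (16 * C))"
proof -
  define G where "G = (\<lambda>e. g (fst e) (snd e))"
  interpret unit_variance_family M G "edge_pairs N E" B using U by (simp add: G_def)
  define s where "s = 1 / sqrt (avg_degree N E)"
  have s: "0 < s" "s\<^sup>2 = 1 / avg_degree N E" using d by (auto simp: s_def power_divide)
  define \<tau> where "\<tau> = (sech (\<beta> * R + \<bar>h\<bar>))\<^sup>2"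
  \<comment> \<open>\<open>D\<close> is whichever of the two kinds of block is often large; \<open>Q\<close> is the other one.\<close>
  obtain D Q where DQ: "(D, Q) = (lower N E, upper N E) \<or> (D, Q) = (upper N E, lower N E)"
    and large: "real N / (4 * C) \<le> card {i \<in> {1..N}. avg_degree N E / 4 \<le> card (D i)}"
    using many_large_blocks[OF graph d C max] by blast
  define S where "S = {i \<in> {1..N}. avg_degree N E / 4 \<le> card (D i)}"
  have cS: "real N / (4 * C) \<le> card S" using large by (simp add: S_def)
  have SN: "S \<subseteq> {1..N}" and fS: "finite S" by (auto simp: S_def)
  have DQ': "(Q, D) = (lower N E, upper N E) \<or> (Q, D) = (upper N E, lower N E)"
    using DQ by auto
  have sub: "D i \<subseteq> edge_pairs N E" "Q i \<subseteq> edge_pairs N E" for i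
    using DQ lower_subset[of N E i] upper_subset[of N E i] by auto
  have deg: "real (card (D i)) \<le> C * avg_degree N E" "real (card (Q i)) \<le> C * avg_degree N E"
    if "i \<in> {1..N}" for i
    using degree_le[OF that max] DQ by (auto simp: degree_eq_lower_upper[OF graph])
  define c where "c = weight N E"
  have abs_c: "\<bar>c \<sigma> i e\<bar> = s" if "\<sigma> \<in> spins N" "e \<in> edge_pairs N E" for \<sigma> i e
  proof -
    have "fst e \<in> {1..N}" "snd e \<in> {1..N}" using edge_pairs_fst_snd[OF that(2)] by auto
    then have "\<sigma> (fst e) \<in> {-1, 1}" "\<sigma> (snd e) \<in> {-1, 1}"
      using that(1) unfolding spins_def by (blast dest: PiE_mem)+
    then show ?thesis using d by (auto simp: c_def weight_def s_def)
  qed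
  have c2: "(\<Sum>e\<in>H. (c \<sigma> i e)\<^sup>2) = card H * s\<^sup>2" if "\<sigma> \<in> spins N" "H \<subseteq> edge_pairs N E" for \<sigma> i H
  proof -
    have "(c \<sigma> i e)\<^sup>2 = s\<^sup>2" if "e \<in> H" for e
      using abs_c[OF \<open>\<sigma> \<in> spins N\<close>, of e i] that \<open>H \<subseteq> _\<close> by (metis power2_abs subsetD)
    then show ?thesis by simp
  qed
  define X where "X = (\<lambda>\<sigma> i \<omega>. \<Sum>e\<in>D i. c \<sigma> i e * G e \<omega>)"
  define Y where "Y = (\<lambda>\<sigma> i \<omega>. \<Sum>e\<in>Q i. c \<sigma> i e * G e \<omega>)"
  have [measurable]: "e \<in> D i \<Longrightarrow> random_variable borel (G e)"
    "e \<in> Q i \<Longrightarrow> random_variable borel (G e)" for e i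
    using sub[of i] by (auto intro: rv)
  have [measurable]: "random_variable borel (X \<sigma> i)" "random_variable borel (Y \<sigma> i)" for \<sigma> i
    unfolding X_def Y_def by measurable
  define m where "m = (\<lambda>\<sigma> \<omega>. local_field N (coupling N E (\<lambda>i j. g i j \<omega>)) \<sigma>)"
  have m: "m \<sigma> \<omega> i = X \<sigma> i \<omega> + Y \<sigma> i \<omega>" if "\<omega> \<in> space M" "i \<in> {1..N}" for \<sigma> \<omega> i
    using local_field_split[OF graph that(2), of "\<lambda>i j. g i j \<omega>" \<sigma>] sym that DQ
    by (auto simp: m_def X_def Y_def c_def G_def)
  define \<I> where "\<I> = {I. I \<subseteq> S \<and> real N / (16 * C) \<le> card I}"
  have \<I>: "finite \<I>" "card \<I> \<le> 2 ^ N"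
  proof -
    have "\<I> \<subseteq> Pow {1..N}" using SN by (auto simp: \<I>_def)
    then show "finite \<I>" "card \<I> \<le> 2 ^ N"
      using finite_subset[of \<I> "Pow {1..N}"] card_mono[of "Pow {1..N}" \<I>] by (auto simp: card_Pow)
  qed
  have spins: "finite (spins N)" "card (spins N) = 2 ^ N" "spins N \<noteq> {}"
    by (auto simp: spins_def card_PiE PiE_eq_empty_iff numeral_2_eq_2 intro!: finite_PiE)
  \<comment> \<open>\<open>A1\<close> and \<open>A2\<close>: one half of the local field is large on all of \<open>I\<close>; \<open>A3\<close>: the local field is
    close to the grid point \<open>k * \<delta>\<close> on all of \<open>I\<close>.\<close>
  define A1 where "A1 = (\<lambda>\<sigma> I. {\<omega> \<in> space M. \<forall>i\<in>I. R / 2 \<le> \<bar>X \<sigma> i \<omega>\<bar>})"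
  define A2 where "A2 = (\<lambda>\<sigma> I. {\<omega> \<in> space M. \<forall>i\<in>I. R / 2 \<le> \<bar>Y \<sigma> i \<omega>\<bar>})"
  define A3 where "A3 = (\<lambda>\<sigma> I k. {\<omega> \<in> space M. \<forall>i\<in>I. \<bar>X \<sigma> i \<omega> + Y \<sigma> i \<omega> - of_int k * \<delta>\<bar> \<le> 2 * \<delta>})"
  define A where "A = (\<lambda>(\<sigma>, I). A1 \<sigma> I \<union> A2 \<sigma> I \<union> (\<Union>k\<in>\<Gamma>. A3 \<sigma> I k))"
  have meas: "A1 \<sigma> I \<in> events" "A2 \<sigma> I \<in> events" "A3 \<sigma> I k \<in> events" if "finite I" for \<sigma> I k
  proof -
    have *: "{\<omega> \<in> space M. R / 2 \<le> \<bar>X \<sigma> i \<omega>\<bar>} \<in> events"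
      "{\<omega> \<in> space M. R / 2 \<le> \<bar>Y \<sigma> i \<omega>\<bar>} \<in> events"
      "{\<omega> \<in> space M. \<bar>X \<sigma> i \<omega> + Y \<sigma> i \<omega> - of_int k * \<delta>\<bar> \<le> 2 * \<delta>} \<in> events" for i
      by measurable
    show "A1 \<sigma> I \<in> events"
      unfolding A1_def by (rule sets.sets_Collect_finite_All[OF *(1) that])
    show "A2 \<sigma> I \<in> events"
      unfolding A2_def by (rule sets.sets_Collect_finite_All[OF *(2) that])
    show "A3 \<sigma> I k \<in> events"
      unfolding A3_def by (rule sets.sets_Collect_finite_All[OF *(3) that])
  qed
  have cheb: "prob {\<omega> \<in> space M. R / 2 \<le> \<bar>\<Sum>e\<in>H. c \<sigma> i e * G e \<omega>\<bar>} \<le> p"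
    if "\<sigma> \<in> spins N" "H \<subseteq> edge_pairs N E" "card H \<le> C * avg_degree N E" for \<sigma> i H
  proof -
    have "prob {\<omega> \<in> space M. R / 2 \<le> \<bar>\<Sum>e\<in>H. c \<sigma> i e * G e \<omega>\<bar>} \<le> card H * s\<^sup>2 / (R / 2)\<^sup>2"
      using tail_weighted_sum[OF that(2), of "R / 2" "c \<sigma> i"] R by (simp add: c2[OF that(1,2)])
    also have "\<dots> \<le> C / (R / 2)\<^sup>2"
      using that(3) d R by (intro divide_right_mono) (auto simp: s field_simps)
    also have "\<dots> = 4 * C / R\<^sup>2" by (simp add: power_divide)
    finally show ?thesis using Rp by linarith
  qed
  have T: "{z :: real \<times> real. R / 2 \<le> \<bar>fst z\<bar>} \<in> sets (borel \<Otimes>\<^sub>M borel)"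
  proof -
    have "{z \<in> space (borel \<Otimes>\<^sub>M borel). R / 2 \<le> \<bar>fst z :: real\<bar>} \<in> sets (borel \<Otimes>\<^sub>M (borel :: real measure))"
      by measurable
    then show ?thesis by (simp only: space_pair_measure space_borel UNIV_Times_UNIV UNIV_I simp_thms)
  qed
  have pA1: "prob (A1 \<sigma> I) \<le> p ^ card I" if "\<sigma> \<in> spins N" "I \<subseteq> {1..N}" for \<sigma> I
  proof -
    have "prob {\<omega> \<in> space M. \<forall>i\<in>I. ((\<Sum>e\<in>D i. c \<sigma> i e * G e \<omega>), (\<Sum>e\<in>Q i. c \<sigma> i e * G e \<omega>))
        \<in> {z :: real \<times> real. R / 2 \<le> \<bar>fst z\<bar>}} \<le> p ^ card I"
      using that p sub deg cheb finite_subset[OF that(2)]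
      by (intro prob_all_vertices_le_power[OF unit_variance_family_axioms DQ _ T]) auto
    then show ?thesis by (simp add: A1_def X_def)
  qed
  have pA2: "prob (A2 \<sigma> I) \<le> p ^ card I" if "\<sigma> \<in> spins N" "I \<subseteq> {1..N}" for \<sigma> I
  proof -
    have "prob {\<omega> \<in> space M. \<forall>i\<in>I. ((\<Sum>e\<in>Q i. c \<sigma> i e * G e \<omega>), (\<Sum>e\<in>D i. c \<sigma> i e * G e \<omega>))
        \<in> {z :: real \<times> real. R / 2 \<le> \<bar>fst z\<bar>}} \<le> p ^ card I"
      using that p sub deg cheb finite_subset[OF that(2)]
      by (intro prob_all_vertices_le_power[OF unit_variance_family_axioms DQ' _ T]) auto
    then show ?thesis by (simp add: A2_def Y_def)
  qed
  have pA3: "prob (A3 \<sigma> I k) \<le> p ^ card I" if \<sigma>: "\<sigma> \<in> spins N" and I: "I \<subseteq> S" for \<sigma> I k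
  proof -
    let ?T = "{z :: real \<times> real. \<bar>fst z + snd z - of_int k * \<delta>\<bar> \<le> 2 * \<delta>}"
    have "{z \<in> space (borel \<Otimes>\<^sub>M borel). \<bar>fst z + snd z - of_int k * \<delta>\<bar> \<le> 2 * \<delta>}
        \<in> sets (borel \<Otimes>\<^sub>M borel)"
      by measurable
    then have T: "?T \<in> sets (borel \<Otimes>\<^sub>M borel)"
      by (simp only: space_pair_measure space_borel UNIV_Times_UNIV UNIV_I simp_thms)
    have "prob {\<omega> \<in> space M. \<bar>(\<Sum>e\<in>D i. c \<sigma> i e * G e \<omega>) - (of_int k * \<delta> - y)\<bar> \<le> 2 * \<delta>} \<le> p"
      if i: "i \<in> I" for i y
    proof (rule order_trans[OF small_ball_weighted_sum[OF sub(1)] ball[folded s_def]])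
      show "\<bar>c \<sigma> i e\<bar> \<le> s" if "e \<in> D i" for e using abs_c[OF \<sigma>, of e i] sub that by auto
      have "1 / 4 \<le> card (D i) * s\<^sup>2" using i I d by (auto simp: S_def s field_simps)
      then show "1 / 4 \<le> (\<Sum>e\<in>D i. (c \<sigma> i e)\<^sup>2)" by (simp add: c2[OF \<sigma> sub(1)])
    qed (use s \<delta> \<epsilon> in auto)
    then have "prob {\<omega> \<in> space M. \<forall>i\<in>I. ((\<Sum>e\<in>D i. c \<sigma> i e * G e \<omega>), (\<Sum>e\<in>Q i. c \<sigma> i e * G e \<omega>))
        \<in> ?T} \<le> p ^ card I"
      using p finite_subset[OF I fS]
      by (intro prob_all_vertices_le_power[OF unit_variance_family_axioms DQ _ T])
        (auto simp: algebra_simps)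
    then show ?thesis by (simp add: A3_def X_def Y_def)
  qed
  have A: "A z \<in> events" "prob (A z) \<le> (2 + real (card \<Gamma>)) * p powr (real N / (16 * C))"
    if z: "z \<in> spins N \<times> \<I>" for z
  proof -
    obtain \<sigma> I where zz: "z = (\<sigma>, I)" and \<sigma>: "\<sigma> \<in> spins N" and I: "I \<subseteq> S"
      and cI: "real N / (16 * C) \<le> card I"
      using z by (auto simp: \<I>_def)
    have fI: "finite I" and IN: "I \<subseteq> {1..N}" using I fS SN finite_subset by auto
    note meas = meas[OF fI, of \<sigma>]
    have \<Gamma>: "finite \<Gamma>" by (simp add: \<Gamma>_def)
    have U: "(\<Union>k\<in>\<Gamma>. A3 \<sigma> I k) \<in> events" using meas \<Gamma> by auto
    show "A z \<in> events" using meas U by (simp add: A_def zz)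
    have "prob (\<Union>k\<in>\<Gamma>. A3 \<sigma> I k) \<le> (\<Sum>k\<in>\<Gamma>. prob (A3 \<sigma> I k))"
      using meas \<Gamma> by (intro finite_measure_subadditive_finite) auto
    also have "\<dots> \<le> (\<Sum>k\<in>\<Gamma>. p ^ card I)" by (intro sum_mono pA3 \<sigma> I)
    finally have 3: "prob (\<Union>k\<in>\<Gamma>. A3 \<sigma> I k) \<le> card \<Gamma> * p ^ card I" by simp
    have "prob (A z) \<le> prob (A1 \<sigma> I \<union> A2 \<sigma> I) + prob (\<Union>k\<in>\<Gamma>. A3 \<sigma> I k)"
      unfolding A_def zz prod.case using meas U by (intro measure_Un_le) auto
    also have "prob (A1 \<sigma> I \<union> A2 \<sigma> I) \<le> prob (A1 \<sigma> I) + prob (A2 \<sigma> I)"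
      using meas by (intro measure_Un_le) auto
    finally have "prob (A z) \<le> (2 + real (card \<Gamma>)) * p ^ card I"
      using 3 pA1[OF \<sigma> IN] pA2[OF \<sigma> IN] by (simp add: algebra_simps)
    also have "p ^ card I = p powr card I" using p by (simp add: powr_realpow)
    also have "\<dots> \<le> p powr (real N / (16 * C))" by (rule powr_mono'[OF cI]) (use p in auto)
    finally show "prob (A z) \<le> (2 + real (card \<Gamma>)) * p powr (real N / (16 * C))"
      by (simp add: mult_left_mono)
  qed
  have cover: "{\<omega> \<in> space M. Min (T_tilde \<beta> h N (coupling N E (\<lambda>i j. g i j \<omega>)) ` spins N) \<le> c0}
      \<subseteq> (\<Union>z\<in>spins N \<times> \<I>. A z)"
  proof
    fix \<omega> assume "\<omega> \<in> {\<omega> \<in> space M.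
      Min (T_tilde \<beta> h N (coupling N E (\<lambda>i j. g i j \<omega>)) ` spins N) \<le> c0}"
    then obtain \<sigma> where \<omega>: "\<omega> \<in> space M" and \<sigma>: "\<sigma> \<in> spins N"
      and T: "T_tilde \<beta> h N (coupling N E (\<lambda>i j. g i j \<omega>)) \<sigma> \<le> c0"
      using spins by (auto simp: Min_le_iff)
    define \<theta> where "\<theta> = theta \<beta> h N (coupling N E (\<lambda>i j. g i j \<omega>)) \<sigma>"
    let ?m = "m \<sigma> \<omega>"
    have "(\<Sum>i=1..N. \<Sum>j=1..N. \<theta> i * \<theta> j * (?m i - ?m j)\<^sup>2) \<le> c0 * (real N)\<^sup>2"
      using T N by (simp add: T_tilde_def \<theta>_def m_def field_simps)
    also have "\<dots> < (\<tau> * \<delta> / (4 * C))\<^sup>2 / 8 * (real N)\<^sup>2"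
      using c0 N by (intro mult_strict_right_mono) (auto simp: \<tau>_def)
    also have "\<dots> = (\<tau> * \<delta> * (real N / (4 * C)))\<^sup>2 / 8" by (simp add: power_mult_distrib power_divide)
    also have "\<dots> \<le> (\<tau> * \<delta> * card S)\<^sup>2 / 8"
      using cS \<delta> C by (intro divide_right_mono power_mono mult_left_mono) (auto simp: \<tau>_def)
    finally have small: "(\<Sum>i=1..N. \<Sum>j=1..N. \<theta> i * \<theta> j * (?m i - ?m j)\<^sup>2)
        < (\<tau> * \<delta> * card S)\<^sup>2 / 8" .
    have \<theta>: "0 \<le> \<theta> i" "\<bar>?m i\<bar> \<le> R \<Longrightarrow> \<tau> \<le> \<theta> i" for i
      using theta_ge[OF \<beta>] by (auto simp: \<theta>_def \<tau>_def m_def) (simp add: theta_def)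
    have quarter: "I \<in> \<I>" if "I \<subseteq> S" "card S \<le> 4 * card I" for I
    proof -
      have "real N / (16 * C) = (real N / (4 * C)) / 4" by simp
      also have "\<dots> \<le> real (card S) / 4" using cS by simp
      also have "\<dots> \<le> card I" using that(2) by linarith
      finally show ?thesis using that(1) by (simp add: \<I>_def)
    qed
    from concentrated_or_large[OF SN \<theta> _ _ small] \<delta>
    have "card S \<le> 2 * card {i \<in> S. R < \<bar>?m i\<bar>} \<or>
      (\<exists>j\<in>S. \<bar>?m j\<bar> \<le> R \<and> card S \<le> 4 * card {i \<in> S. \<bar>?m i - ?m j\<bar> \<le> \<delta>})"
      by (simp add: \<tau>_def)
    then show "\<omega> \<in> (\<Union>z\<in>spins N \<times> \<I>. A z)"
    proof
      assume half: "card S \<le> 2 * card {i \<in> S. R < \<bar>?m i\<bar>}"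
      define I1 where "I1 = {i \<in> S. R / 2 \<le> \<bar>X \<sigma> i \<omega>\<bar>}"
      define I2 where "I2 = {i \<in> S. R / 2 \<le> \<bar>Y \<sigma> i \<omega>\<bar>}"
      have "R / 2 \<le> \<bar>X \<sigma> i \<omega>\<bar> \<or> R / 2 \<le> \<bar>Y \<sigma> i \<omega>\<bar>" if "i \<in> S" "R < \<bar>?m i\<bar>" for i
        using that m[OF \<omega>, of i \<sigma>] SN by (auto simp: abs_if split: if_splits)
      then have "{i \<in> S. R < \<bar>?m i\<bar>} \<subseteq> I1 \<union> I2" by (auto simp: I1_def I2_def)
      then have "card {i \<in> S. R < \<bar>?m i\<bar>} \<le> card (I1 \<union> I2)"
        using fS by (intro card_mono) (auto simp: I1_def I2_def)
      also have "\<dots> \<le> card I1 + card I2" by (rule card_Un_le)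
      finally have "card S \<le> 4 * card I1 \<or> card S \<le> 4 * card I2" using half by linarith
      then have "I1 \<in> \<I> \<or> I2 \<in> \<I>" using quarter by (auto simp: I1_def I2_def)
      moreover have "\<omega> \<in> A (\<sigma>, I1)" "\<omega> \<in> A (\<sigma>, I2)"
        using \<omega> by (auto simp: A_def A1_def A2_def I1_def I2_def)
      ultimately show ?thesis using \<sigma> by blast
    next
      assume "\<exists>j\<in>S. \<bar>?m j\<bar> \<le> R \<and> card S \<le> 4 * card {i \<in> S. \<bar>?m i - ?m j\<bar> \<le> \<delta>}"
      then obtain j where j: "\<bar>?m j\<bar> \<le> R" "card S \<le> 4 * card {i \<in> S. \<bar>?m i - ?m j\<bar> \<le> \<delta>}"
        by blast
      define I where "I = {i \<in> S. \<bar>?m i - ?m j\<bar> \<le> \<delta>}"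
      obtain k where k: "k \<in> \<Gamma>" "\<bar>?m j - of_int k * \<delta>\<bar> \<le> \<delta>"
        using exists_grid_point[OF \<delta> j(1)] unfolding \<Gamma>_def by blast
      have "\<bar>X \<sigma> i \<omega> + Y \<sigma> i \<omega> - of_int k * \<delta>\<bar> \<le> 2 * \<delta>" if "i \<in> I" for i
      proof -
        have i: "i \<in> {1..N}" "\<bar>?m i - ?m j\<bar> \<le> \<delta>" using that SN by (auto simp: I_def)
        show ?thesis using i(2) k(2) unfolding m[OF \<omega> i(1), symmetric] by linarith
      qed
      then have "\<omega> \<in> A (\<sigma>, I)" using k(1) \<omega> by (auto simp: A_def A3_def)
      moreover have "I \<in> \<I>" using j(2) by (intro quarter) (auto simp: I_def)
      ultimately show ?thesis using \<sigma> by blast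
    qed
  qed
  have fin: "finite (spins N \<times> \<I>)" using spins \<I> by simp
  have "prob {\<omega> \<in> space M. Min (T_tilde \<beta> h N (coupling N E (\<lambda>i j. g i j \<omega>)) ` spins N) \<le> c0}
      \<le> prob (\<Union>z\<in>spins N \<times> \<I>. A z)"
    using cover A fin by (intro finite_measure_mono) auto
  also have "\<dots> \<le> (\<Sum>z\<in>spins N \<times> \<I>. prob (A z))"
    using A fin by (intro finite_measure_subadditive_finite) auto
  also have "\<dots> \<le> (\<Sum>z\<in>spins N \<times> \<I>. (2 + real (card \<Gamma>)) * p powr (real N / (16 * C)))"
    by (intro sum_mono A)
  also have "\<dots> = real (card (spins N \<times> \<I>)) * ((2 + real (card \<Gamma>)) * p powr (real N / (16 * C)))"
    by simp
  also have "\<dots> \<le> 4 ^ N * ((2 + real (card \<Gamma>)) * p powr (real N / (16 * C)))"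
  proof (intro mult_right_mono)
    have "card (spins N \<times> \<I>) \<le> 2 ^ N * 2 ^ N" using spins \<I> by (simp add: card_cartesian_product)
    also have "\<dots> = 4 ^ N" by (simp add: power_mult_distrib[symmetric])
    finally show "real (card (spins N \<times> \<I>)) \<le> 4 ^ N"
      by (metis of_nat_le_iff of_nat_numeral of_nat_power)
  qed auto
  finally show ?thesis by (simp add: mult_ac)
qed

theorem theorem1p5:
  fixes \<beta> h B C :: real
    and E :: "nat \<Rightarrow> nat set set"
    and M :: "nat \<Rightarrow> 'a measure"
    and g :: "nat \<Rightarrow> nat \<Rightarrow> nat \<Rightarrow> 'a \<Rightarrow> real"
  assumes "\<beta> > 0" and "B > 0" and "C > 0"
    and graph: "\<And>N. N \<ge> 2 \<Longrightarrow> simple_graph N (E N)"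
    and edge: "\<And>N. N \<ge> 2 \<Longrightarrow> E N \<noteq> {}"
    and max_deg: "\<And>N. N \<ge> 2 \<Longrightarrow> real (max_degree N (E N)) \<le> C * avg_degree N (E N)"
    and avg_deg: "filterlim (\<lambda>N. avg_degree N (E N)) at_top sequentially"
    and prob: "\<And>N. N \<ge> 2 \<Longrightarrow> prob_space (M N)"
    and symm: "\<And>N i j \<omega>. \<lbrakk>N \<ge> 2; i \<in> {1..N}; j \<in> {1..N}; \<omega> \<in> space (M N)\<rbrakk>
      \<Longrightarrow> g N i j \<omega> = g N j i \<omega>"
    and diag: "\<And>N i \<omega>. \<lbrakk>N \<ge> 2; i \<in> {1..N}; \<omega> \<in> space (M N)\<rbrakk> \<Longrightarrow> g N i i \<omega> = 0"
    and indep: "\<And>N. N \<ge> 2 \<Longrightarrow> prob_space.indep_vars (M N) (\<lambda>_. borel) (\<lambda>(i, j). g N i j)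
      {(i, j). i \<in> {1..N} \<and> j \<in> {1..N} \<and> j < i}"
    and mean: "\<And>N i j. \<lbrakk>N \<ge> 2; i \<in> {1..N}; j \<in> {1..N}; j < i\<rbrakk>
      \<Longrightarrow> (\<integral>\<omega>. g N i j \<omega> \<partial>M N) = 0"
    and var: "\<And>N i j. \<lbrakk>N \<ge> 2; i \<in> {1..N}; j \<in> {1..N}; j < i\<rbrakk>
      \<Longrightarrow> (\<integral>\<omega>. (g N i j \<omega>)\<^sup>2 \<partial>M N) = 1"
    and third_int: "\<And>N i j. \<lbrakk>N \<ge> 2; i \<in> {1..N}; j \<in> {1..N}; j < i\<rbrakk>
      \<Longrightarrow> integrable (M N) (\<lambda>\<omega>. \<bar>g N i j \<omega>\<bar> ^ 3)"
    and third: "\<And>N i j. \<lbrakk>N \<ge> 2; i \<in> {1..N}; j \<in> {1..N}; j < i\<rbrakk>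
      \<Longrightarrow> (\<integral>\<omega>. \<bar>g N i j \<omega>\<bar> ^ 3 \<partial>M N) \<le> B"
  shows "\<exists>c0 c K. c0 > 0 \<and> c > 0 \<and> K > 0 \<and> (\<forall>N\<ge>2.
    measure (M N) {\<omega> \<in> space (M N).
      Min (T_tilde \<beta> h N (coupling N (E N) (\<lambda>i j. g N i j \<omega>)) ` spins N) \<le> c0}
    \<le> K * exp (- c * real N))"
proof -
  \<comment> \<open>With \<open>card I \<ge> N / (16 C)\<close> this makes \<open>p ^ card I\<close> at most \<open>8 powr (- N)\<close>, which beats the \<open>4 ^ N\<close>
    choices of \<open>\<sigma>\<close> and \<open>I\<close>.\<close>
  define p where "p = 8 powr (- (16 * C))"
  have p: "0 < p" "p < 1" using \<open>C > 0\<close> by (auto simp: p_def powr_less_one)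
  define R where "R = sqrt (4 * C / p)"
  have R: "0 < R" "R\<^sup>2 = 4 * C / p" using \<open>C > 0\<close> p by (auto simp: R_def)
  \<comment> \<open>The choices of \<open>\<epsilon>\<close>, \<open>\<delta>\<close> and \<open>d0\<close> make each of the three terms of the small ball estimate at
    most \<open>p / 3\<close>.\<close>
  define \<epsilon> where "\<epsilon> = p / 12"
  define \<delta> where "\<delta> = \<epsilon> / (2 * sqrt (12 * ln (6 / p)))"
  have l: "0 < ln (6 / p)" using p by simp
  have \<epsilon>: "0 < \<epsilon>" and \<delta>: "0 < \<delta>" using p l by (auto simp: \<epsilon>_def \<delta>_def)
  define B' where "B' = max B 1"
  define d0 where "d0 = 1 + 3 * B'\<^sup>2 / (2 * \<delta>\<^sup>2 * p)"
  have d0: "1 \<le> d0" using \<delta> p by (simp add: d0_def)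
  obtain N0 where N0: "\<And>N. N \<ge> N0 \<Longrightarrow> d0 \<le> avg_degree N (E N)"
    using avg_deg unfolding filterlim_at_top eventually_sequentially by meson
  define c0 where "c0 = ((sech (\<beta> * R + \<bar>h\<bar>))\<^sup>2 * \<delta> / (4 * C))\<^sup>2 / 16"
  have sech: "0 < sech (\<beta> * R + \<bar>h\<bar>)" by (simp add: sech_def cosh_real_pos)
  then have c0: "0 < c0" using \<delta> \<open>C > 0\<close> by (simp add: c0_def)
  define L where "L = 2 + real (card {- (\<lceil>R / \<delta>\<rceil> + 1)..\<lceil>R / \<delta>\<rceil> + 1})"
  have ball: "2 * (2 * \<epsilon> + exp (- (1/4) * (\<epsilon> / (2 * \<delta>))\<^sup>2 / 3) + (1 / sqrt d * B' / (2 * \<delta>))\<^sup>2) \<le> p"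
    if d: "d0 \<le> d" for d
  proof -
    have dpos: "0 < d" using d d0 by linarith
    have "\<epsilon> / (2 * \<delta>) = sqrt (12 * ln (6 / p))" using \<epsilon> l by (simp add: \<delta>_def)
    then have "(\<epsilon> / (2 * \<delta>))\<^sup>2 = 12 * ln (6 / p)" using l by simp
    then have "exp (- (1/4) * (\<epsilon> / (2 * \<delta>))\<^sup>2 / 3) = exp (- ln (6 / p))" by simp
    also have "\<dots> = p / 6" using p by (simp add: exp_minus)
    finally have 1: "exp (- (1/4) * (\<epsilon> / (2 * \<delta>))\<^sup>2 / 3) = p / 6" .
    have "3 * B'\<^sup>2 / (2 * \<delta>\<^sup>2 * p) \<le> d" using d by (simp add: d0_def)
    then have "3 * B'\<^sup>2 \<le> d * (2 * \<delta>\<^sup>2 * p)" using \<delta> p by (simp add: pos_divide_le_eq)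
    then have "B'\<^sup>2 / (d * (4 * \<delta>\<^sup>2)) \<le> p / 6" using \<delta> dpos by (simp add: field_simps)
    moreover have "(1 / sqrt d * B' / (2 * \<delta>))\<^sup>2 = B'\<^sup>2 / (d * (4 * \<delta>\<^sup>2))"
      using dpos by (simp add: power_divide power_mult_distrib)
    ultimately show ?thesis using 1 by (simp add: \<epsilon>_def)
  qed
  have main: "measure (M N) {\<omega> \<in> space (M N).
      Min (T_tilde \<beta> h N (coupling N (E N) (\<lambda>i j. g N i j \<omega>)) ` spins N) \<le> c0}
    \<le> L * exp (- ln 2 * real N)" if N: "N \<ge> 2" "N \<ge> N0" for N
  proof -
    interpret prob_space "M N" by (rule prob[OF N(1)])
    have P: "fst e \<in> {1..N}" "snd e \<in> {1..N}" "snd e < fst e" if "e \<in> edge_pairs N (E N)" for e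
      using edge_pairs_fst_snd[OF that] by auto
    have U: "unit_variance_family (M N) (\<lambda>e. g N (fst e) (snd e)) (edge_pairs N (E N)) B'"
    proof
      show "indep_vars (\<lambda>_. borel) (\<lambda>e. g N (fst e) (snd e)) (edge_pairs N (E N))"
        using indep_vars_subset[OF indep[OF N(1)], of "edge_pairs N (E N)"]
        by (auto simp: edge_pairs_def case_prod_beta')
      show "expectation (\<lambda>\<omega>. \<bar>g N (fst e) (snd e) \<omega>\<bar> ^ 3) \<le> B'" if "e \<in> edge_pairs N (E N)" for e
        using third[OF N(1) P[OF that]] by (simp add: B'_def)
    qed (use mean[OF N(1) P] var[OF N(1) P] third_int[OF N(1) P] in \<open>auto simp: B'_def\<close>)
    have d: "0 < avg_degree N (E N)" using N0[OF N(2)] d0 by linarith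
    have "measure (M N) {\<omega> \<in> space (M N).
        Min (T_tilde \<beta> h N (coupling N (E N) (\<lambda>i j. g N i j \<omega>)) ` spins N) \<le> c0}
      \<le> L * 4 ^ N * p powr (real N / (16 * C))"
      unfolding L_def
    proof (rule prob_T_tilde_small_le[OF U graph[OF N(1)]])
      show "4 * C / R\<^sup>2 \<le> p" using R p \<open>C > 0\<close> by simp
      show "c0 < ((sech (\<beta> * R + \<bar>h\<bar>))\<^sup>2 * \<delta> / (4 * C))\<^sup>2 / 8"
        using c0 unfolding c0_def by simp
    qed (use N \<open>\<beta> > 0\<close> \<open>C > 0\<close> p R \<delta> \<epsilon> d symm max_deg[OF N(1)] ball[OF N0[OF N(2)]] in auto)
    also have "p powr (real N / (16 * C)) = 8 powr (- real N)"
      using \<open>C > 0\<close> by (simp add: p_def powr_powr)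
    also have "\<dots> = 1 / 8 ^ N" by (simp add: powr_minus powr_realpow divide_inverse)
    also have "(8::real) ^ N = 4 ^ N * 2 ^ N" by (simp add: power_mult_distrib[symmetric])
    also have "L * 4 ^ N * (1 / (4 ^ N * 2 ^ N)) = L * (1 / 2) ^ N"
      by (simp add: power_one_over)
    also have "(1 / 2) ^ N = exp (- ln 2 * real N)"
    proof -
      have "exp (- ln 2 * real N) = exp (- ln 2 :: real) ^ N" by (rule exp_of_nat2_mult)
      also have "exp (- ln 2 :: real) = 1 / 2" by (simp add: exp_minus)
      finally show ?thesis ..
    qed
    finally show ?thesis .
  qed
  define K where "K = L + exp (ln 2 * real N0)"
  have L: "0 < L" by (simp add: L_def add_pos_nonneg)
  show ?thesis
  proof (intro exI conjI allI impI)
    show "0 < c0" by fact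
    show "(0::real) < ln 2" by simp
    show "0 < K" using L by (simp add: K_def add_pos_pos)
    fix N :: nat assume N: "2 \<le> N"
    interpret prob_space "M N" by (rule prob[OF N])
    let ?P = "measure (M N) {\<omega> \<in> space (M N).
      Min (T_tilde \<beta> h N (coupling N (E N) (\<lambda>i j. g N i j \<omega>)) ` spins N) \<le> c0}"
    show "?P \<le> K * exp (- ln 2 * real N)"
    proof (cases "N0 \<le> N")
      case True
      have "?P \<le> L * exp (- ln 2 * real N)" by (rule main[OF N True])
      also have "\<dots> \<le> K * exp (- ln 2 * real N)" by (intro mult_right_mono) (auto simp: K_def)
      finally show ?thesis .
    next
      case False
      have "?P \<le> 1" by (rule prob_le_1)
      also have "1 \<le> exp (ln 2 * real N0) * exp (- ln 2 * real N)"
        using False by (simp add: exp_add[symmetric] mult_left_mono)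
      also have "\<dots> \<le> K * exp (- ln 2 * real N)"
        using L by (intro mult_right_mono) (auto simp: K_def)
      finally show ?thesis .
    qed
  qed
qed

end
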